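(* Let $\beta>0$ be a fixed constant and let $m = m(n)$, $n = 1, 2, \ldots$, be a sequence of positive integers satisfying $$m(n) = \beta \ln n + b(n) \ln n, \qquad \text{where } b(n) = o\left(\frac{1}{\sqrt{\ln n}}\right) \text{ as } n\to\infty.$$ Let $\alpha$ be the unique solution of the equation $\alpha - \beta\ln \alpha = \beta - \beta \ln\beta + 1$ in the interval $(\beta,\infty)$. Then, for any fixed $y \in \mathbb{R}$, $$\lim_{n \rightarrow \infty} \mathbb{P}\left\{\frac{D_{m,n} - \alpha n \ln n - \frac{\alpha(\alpha-\beta-1)}{\beta(\alpha-\beta)} \, b(n)\, n \ln n + \frac{\alpha}{2(\alpha-\beta)} \, n \ln \ln n}{\frac{\alpha}{\alpha-\beta} \, n} \leq y\right\} = \exp \left(-\frac{1}{\sqrt{2\pi}} \, \frac{\sqrt{\beta}}{\alpha - \beta} \, e^{-y}\right).$$ Equivalently, $$\frac{\alpha-\beta}{\alpha} \, m \left(\frac{D_{m,n}}{n m} - \frac{\alpha}{\beta}\right) + \frac{b(n)}{\beta} \, \ln n + \frac{\ln \ln n}{2} + C \, \overset{d}{\longrightarrow} \, G \qquad (n\to\infty),$$ where $$C := \frac{1}{2}\ln\left(\frac{2\pi(\alpha-\beta)^2}{\beta}\right)$$ and $G$ is the standard Gumbel random variable.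
   Context: Coupon collector setting: $n$ equally likely coupons are sampled independently with replacement (each trial yields coupon $j$ with probability $1/n$, $j=1,\dots,n$). For positive integers $m,n$, $D_{m,n}$ denotes the number of trials needed until all $n$ coupons have been detected at least $m$ times each. The standard Gumbel random variable $G$ has distribution function $\mathbb{P}\{G\le y\}=e^{-e^{-y}}$, $y\in\mathbb{R}$. The symbol $\overset{d}{\longrightarrow}$ denotes convergence in distribution. Expressions involving $b(n)$ or $\ln\ln n$ are considered for $n\ge 2$. *)

theory Defs
  imports "HOL-Probability.Probability" "HOL-Library.Landau_Symbols" "HOL-Real_Asymp.Real_Asymp"
begin

locale coupon_sampling = prob_space M
  for M :: "'a measure" and n :: nat and X :: "nat \<Rightarrow> 'a \<Rightarrow> nat" +
  assumes indep_trials: "indep_vars (\<lambda>_. count_space UNIV) X UNIV"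
    and uniform_trials: "\<And>i j. j \<in> {1..n} \<Longrightarrow> prob {\<omega> \<in> space M. X i \<omega> = j} = 1 / real n"

text \<open>
  \<open>X 0, X 1, \<dots>\<close> are the outcomes of trials 1, 2, \dots, so \<open>i < t\<close> selects the first \<open>t\<close> trials.
  If some coupon is never collected \<open>m\<close> times, the set is empty and its infimum is \<open>0\<close>;
  under \<open>coupon_sampling\<close> (with \<open>n \<ge> 1\<close>) this happens with probability 0 only.
\<close>

definition coupon_time :: "nat \<Rightarrow> nat \<Rightarrow> (nat \<Rightarrow> 'a \<Rightarrow> nat) \<Rightarrow> 'a \<Rightarrow> nat" where
  "coupon_time m n X \<omega> = Inf {t. \<forall>j\<in>{1..n}. m \<le> card {i. i < t \<and> X i \<omega> = j}}"

definition standard_gumbel :: "real measure" where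
  "standard_gumbel = interval_measure (\<lambda>y. exp (- exp (- y)))"

lemma real_distribution_standard_gumbel: "real_distribution standard_gumbel"
  unfolding standard_gumbel_def
proof (rule real_distribution_interval_measure)
  show "((\<lambda>y::real. exp (- exp (- y))) \<longlongrightarrow> 0) at_bot"
    by real_asymp
  show "((\<lambda>y::real. exp (- exp (- y))) \<longlongrightarrow> 1) at_top"
    by real_asymp
qed (auto intro!: continuous_intros)

lemma cdf_standard_gumbel: "cdf standard_gumbel = (\<lambda>y. exp (- exp (- y)))"
  unfolding standard_gumbel_def
proof (rule cdf_interval_measure)
  show "((\<lambda>y::real. exp (- exp (- y))) \<longlongrightarrow> 0) at_bot"
    by real_asymp
qed (auto intro!: continuous_intros)

text \<open>Every \<open>n \<ge> 1\<close> admits such a sampling scheme.\<close>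

lemma coupon_sampling_exists:
  assumes "n \<ge> 1"
  shows "coupon_sampling (\<Pi>\<^sub>M i\<in>UNIV. measure_pmf (pmf_of_set {1..n})) n (\<lambda>i \<omega>. \<omega> i)"
proof -
  let ?N = "\<lambda>i::nat. measure_pmf (pmf_of_set {1..n})"
  interpret P: product_prob_space ?N UNIV
    by unfold_locales
  have rv: "(\<lambda>\<omega>. \<omega> i) \<in> measurable (PiM UNIV ?N) (?N i)" for i
    by (rule measurable_component_singleton) simp
  have comp: "distr (PiM UNIV ?N) (?N i) (\<lambda>\<omega>. \<omega> i) = ?N i" for i
    using P.PiM_component[of i] by simp
  show ?thesis
  proof
    have "P.indep_vars ?N (\<lambda>i \<omega>. \<omega> i) UNIV"
      by (subst P.indep_vars_iff_distr_eq_PiM)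
        (simp_all only: comp rv restrict_UNIV distr_id2 UNIV_not_empty not_False_eq_True)
    from P.indep_vars_compose2[OF this, of "\<lambda>_ x. x" "\<lambda>_. count_space UNIV"]
    show "P.indep_vars (\<lambda>_. count_space UNIV) (\<lambda>i \<omega>. \<omega> i) UNIV"
      by simp
    fix i j :: nat assume j: "j \<in> {1..n}"
    have "P.prob {\<omega> \<in> space (PiM UNIV ?N). \<omega> i = j}
        = measure (distr (PiM UNIV ?N) (?N i) (\<lambda>\<omega>. \<omega> i)) {j}"
      by (subst measure_distr[OF rv]) (simp_all only: vimage_def Int_def singleton_iff mem_Collect_eq conj_commute sets_measure_pmf UNIV_I)
    also have "\<dots> = pmf (pmf_of_set {1..n}) j"
      unfolding comp by (rule measure_pmf_single)
    also have "\<dots> = 1 / real n"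
      using j assms by (subst pmf_of_set) (auto simp: indicator_def)
    finally show "P.prob {\<omega> \<in> space (PiM UNIV ?N). \<omega> i = j} = 1 / real n" .
  qed
qed

end

theory Submission
  imports Defs
begin

text \<open>
  Poissonization: after a Poisson number of trials with mean \<open>n \<lambda>\<close>, the numbers of copies of
  the \<open>n\<close> coupons are independent Poisson variables with mean \<open>\<lambda>\<close>, so the probability of having
  \<open>m\<close> copies of each is exactly \<open>(1 - p)^n\<close> with \<open>p = P(Poisson(\<lambda>) < m)\<close>. Since completeness of the
  collection is monotone in the number of trials, Chebyshev's inequality for the Poisson
  distribution transfers this to a fixed number of trials: an error of order \<open>n\<close> in the number of
  trials is much larger than its standard deviation, of order \<open>sqrt (n ln n)\<close>. It remains to choose \<open>\<lambda>\<close>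
  such that \<open>n p\<close> converges. The lower tail sum is asymptotically a geometric series times the term
  \<open>r = m\<close>, which Stirling's formula evaluates; the defining equation of \<open>\<alpha>\<close> cancels the order
  \<open>ln n\<close> in the exponent, and the condition on \<open>b\<close> makes the quadratic error \<open>b\<^sup>2 ln n\<close> negligible.
\<close>

section \<open>Stirling's formula\<close>

lemma wallis_product_fact:
  \<comment> \<open>Puts the partial products of Wallis' formula into factorials, so that
    \<open>wallis\<close> can fix the constant in Stirling's formula.\<close>
  "(\<Prod>k=1..n. (4*real k^2) / (4*real k^2 - 1)) = 2 ^ (4*n) * fact n ^ 4 / (fact (2*n) ^ 2 * (2 * real n + 1))"
proof (induction n)
  case (Suc n)
  have nz: "4 * real (Suc n)^2 - 1 = (2 * real n + 1) * (2 * real n + 3)"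
    by (simp add: power2_eq_square algebra_simps)
  have "(\<Prod>k=1..Suc n. (4*real k^2) / (4*real k^2 - 1)) =
      2 ^ (4*n) * fact n ^ 4 / (fact (2*n) ^ 2 * (2 * real n + 1)) * (4 * real (Suc n)^2 / ((2 * real n + 1) * (2 * real n + 3)))"
    using Suc.IH nz by simp
  also have "\<dots> = 2 ^ (4*Suc n) * fact (Suc n) ^ 4 / (fact (2*Suc n) ^ 2 * (2 * real (Suc n) + 1))"
  proof -
    have f: "fact (2 * Suc n) = 2 * real (Suc n) * (2 * real n + 1) * fact (2*n)"
      by (simp add: algebra_simps)
    show ?thesis
      unfolding f fact_Suc
      by (simp add: divide_simps power_mult_distrib power_add del: fact_Suc of_nat_Suc)
         (simp add: eval_nat_numeral algebra_simps)
  qed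
  finally show ?case .
qed simp

text \<open>The increments of the Stirling error \<open>d\<close> are of order
  \<open>1 / n^2\<close>, hence summable, so \<open>d\<close> has a limit. In
  \<open>4 * d n - 2 * d (2 * n)\<close> the terms in \<open>n ln n\<close> and \<open>n\<close>
  cancel up to the power of 2 in the Wallis product; since this combination tends to twice the limit
  of \<open>d\<close>, the value \<open>pi / 2\<close> identifies that limit.\<close>

lemma ln_fact_stirling:
  "(\<lambda>n. ln (fact n) - ((real n + 1/2) * ln (real n) - real n)) \<longlonglongrightarrow> ln (2 * pi) / 2"
proof -
  define d where "d = (\<lambda>n. ln (fact n) - ((real n + 1/2) * ln (real n) - real n))"
  have step: "d (Suc n) - d n = 1 - (real n + 1/2) * (ln (real (Suc n)) - ln (real n))" if "n \<ge> 1" for n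
  proof -
    have "ln (fact (Suc n) :: real) = ln (real (Suc n)) + ln (fact n)"
      unfolding fact_Suc by (subst ln_mult) auto
    then show ?thesis by (simp add: d_def algebra_simps del: fact_Suc)
  qed
  have "(\<lambda>n::nat. 1 - (real n + 1/2) * (ln (real (Suc n)) - ln (real n))) \<in> O(\<lambda>n. 1 / real n ^ 2)"
    by real_asymp
  moreover have "eventually (\<lambda>n. d (Suc n) - d n = 1 - (real n + 1/2) * (ln (real (Suc n)) - ln (real n))) sequentially"
    using step by (intro eventually_sequentiallyI[of 1]) auto
  ultimately have "(\<lambda>n. d (Suc n) - d n) \<in> O(\<lambda>n. 1 / real n ^ 2)"
    by (subst landau_o.big.in_cong)
  moreover have "summable (\<lambda>n. norm (1 / real n ^ 2))"
    using inverse_power_summable[of 2, where 'a = real] by (simp add: inverse_eq_divide)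
  ultimately have "summable (\<lambda>n. d (Suc n) - d n)"
    by (rule summable_comparison_test_bigo[rotated])
  then obtain s where "(\<lambda>n. \<Sum>k<n. d (Suc k) - d k) \<longlonglongrightarrow> s"
    by (auto simp: summable_def sums_def)
  then have "(\<lambda>n. d n - d 0 + d 0) \<longlonglongrightarrow> s + d 0"
    by (intro tendsto_intros) (simp add: sum_lessThan_telescope)
  then have lim: "d \<longlonglongrightarrow> s + d 0" by simp
  have "(\<lambda>n. d (2 * n)) \<longlonglongrightarrow> s + d 0"
    using lim by (rule filterlim_compose) (simp add: filterlim_subseq strict_mono_def)
  \<comment> \<open>The rational factor is exactly what separates
    \<open>exp (4 * d n - 2 * d (2 * n))\<close> from the Wallis product. It tends to 1/4.\<close>
  then have lim2: "(\<lambda>n. exp (4 * d n - 2 * d (2 * n)) * (real n / (2 * (2 * real n + 1))))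
      \<longlonglongrightarrow> exp (4 * (s + d 0) - 2 * (s + d 0)) * (1 / 4)"
    using lim by (intro tendsto_mult tendsto_exp tendsto_diff tendsto_const) (assumption | real_asymp)+
  have eq: "exp (4 * d n - 2 * d (2 * n)) * (real n / (2 * (2 * real n + 1)))
      = (\<Prod>k=1..n. (4*real k^2) / (4*real k^2 - 1))" if "n \<ge> 1" for n
  proof -
    have "ln (2 ^ (4*n) * fact n ^ 4 / (fact (2*n) ^ 2 * (2 * real n + 1)))
        = 4 * real n * ln 2 + 4 * ln (fact n) - 2 * ln (fact (2*n)) - ln (2 * real n + 1)"
      by (subst ln_div ln_mult; simp add: ln_realpow add_pos_nonneg)+
    also have "\<dots> = 4 * d n - 2 * d (2 * n) + (ln (real n) - (ln 2 + ln (2 * real n + 1)))"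
      using that by (simp add: d_def ln_mult field_simps)
    finally have "exp (4 * d n - 2 * d (2 * n) + (ln (real n) - (ln 2 + ln (2 * real n + 1))))
        = 2 ^ (4*n) * fact n ^ 4 / (fact (2*n) ^ 2 * (2 * real n + 1))"
      by (metis exp_ln divide_pos_pos fact_gt_zero mult_pos_pos zero_less_power zero_less_numeral of_nat_0_le_iff add_nonneg_pos mult_nonneg_nonneg zero_le_numeral zero_less_one)
    then show ?thesis
      unfolding wallis_product_fact using that
      by (simp add: exp_add exp_diff add_pos_nonneg)
  qed
  have "(\<lambda>n. \<Prod>k=1..n. (4*real k^2) / (4*real k^2 - 1)) \<longlonglongrightarrow> exp (4 * (s + d 0) - 2 * (s + d 0)) * (1 / 4)"
    using lim2 by (rule Lim_transform_eventually) (use eq in \<open>auto intro!: eventually_sequentiallyI[of 1]\<close>)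
  then have "exp (4 * (s + d 0) - 2 * (s + d 0)) * (1 / 4) = pi / 2"
    using wallis by (rule LIMSEQ_unique)
  then have "exp (2 * (s + d 0)) = 2 * pi" by simp
  then have "s + d 0 = ln (2 * pi) / 2"
    by (metis ln_exp nonzero_mult_div_cancel_left zero_neq_numeral)
  with lim have "d \<longlonglongrightarrow> ln (2 * pi) / 2" by (simp only:)
  then show ?thesis unfolding d_def .
qed

section \<open>Lower tail of the Poisson distribution\<close>

lemma prod_falling_fact:
  assumes "k < m"
  shows "(\<Prod>i\<le>k. real m - real i) = fact m / fact (m - Suc k)"
  using assms
proof (induction k)
  case 0
  then show ?case by (cases m) auto
next
  case (Suc k)
  then have "fact (m - Suc k) = (real m - real (Suc k)) * fact (m - Suc (Suc k))"
    by (metis Suc_diff_Suc diff_Suc_less fact_Suc of_nat_diff less_imp_le of_nat_fact)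
  then have "(fact m / fact (m - Suc k)) * (real m - real (Suc k)) = fact m / fact (m - Suc (Suc k))"
    using Suc.prems by (simp add: divide_simps del: of_nat_Suc)
  then show ?case using Suc by simp
qed

text \<open>Reverse the summation by \<open>r = m - Suc k\<close>; each quotient by the term at
  \<open>m\<close> is then a product of falling factors over \<open>x\<close>. For \<open>k\<close>
  at least \<open>m\<close> the factor \<open>i = m\<close> vanishes, so the sum may run over all
  \<open>k\<close>, an index range independent of \<open>m\<close>, as Tannery's theorem
  requires.\<close>

lemma sum_exp_coeffs_eq:
  fixes x :: real
  assumes "x > 0"
  shows "(\<Sum>r<m. x ^ r / fact r) / (x ^ m / fact m) = (\<Sum>k. \<Prod>i\<le>k. (real m - real i) / x)"
proof -
  have "(\<Sum>k. \<Prod>i\<le>k. (real m - real i) / x) = (\<Sum>k<m. \<Prod>i\<le>k. (real m - real i) / x)"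
    by (intro suminf_finite) (auto simp: prod_zero_iff)
  also have "\<dots> = (\<Sum>k<m. (x ^ (m - Suc k) / fact (m - Suc k)) / (x ^ m / fact m))"
  proof (intro sum.cong refl)
    fix k assume "k \<in> {..<m}"
    then have k: "k < m" by simp
    then have "x ^ m = x ^ Suc k * x ^ (m - Suc k)"
      by (simp del: power_Suc flip: power_add)
    with k show "(\<Prod>i\<le>k. (real m - real i) / x) = (x ^ (m - Suc k) / fact (m - Suc k)) / (x ^ m / fact m)"
      using assms by (simp add: prod_dividef prod_falling_fact field_simps)
  qed
  also have "\<dots> = (\<Sum>r<m. (x ^ r / fact r) / (x ^ m / fact m))"
    by (rule sum.nat_diff_reindex)
  finally show ?thesis by (simp only: sum_divide_distrib)
qed

text \<open>For fixed \<open>k\<close> the product tends to \<open>\<rho> ^ Suc k\<close>, and a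
  geometric series dominates, so the limit is the geometric series in \<open>\<rho>\<close>.\<close>

lemma sum_exp_coeffs_ratio:
  fixes x :: "nat \<Rightarrow> real" and m :: "nat \<Rightarrow> nat"
  assumes x: "filterlim x at_top sequentially"
    and lim: "(\<lambda>n. real (m n) / x n) \<longlonglongrightarrow> \<rho>" and "0 \<le> \<rho>" "\<rho> < 1"
  shows "(\<lambda>n. (\<Sum>r<m n. x n ^ r / fact r) / (x n ^ m n / fact (m n))) \<longlonglongrightarrow> \<rho> / (1 - \<rho>)"
proof -
  \<comment> \<open>Halfway between \<open>\<rho>\<close> and 1: eventually above
    \<open>m n / x n\<close>, yet still the ratio of a convergent geometric series.\<close>
  define \<sigma> where "\<sigma> = (1 + \<rho>) / 2"
  have \<sigma>: "\<rho> < \<sigma>" "0 < \<sigma>" "\<sigma> < 1" using assms by (auto simp: \<sigma>_def)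
  have ev: "eventually (\<lambda>n. x n > 0 \<and> real (m n) / x n \<le> \<sigma>) sequentially"
    using x order_tendstoD(2)[OF lim \<sigma>(1)]
    unfolding filterlim_at_top_dense by (intro eventually_conj) (auto elim: eventually_mono)
  have "(\<lambda>n. \<Sum>k. \<Prod>i\<le>k. (real (m n) - real i) / x n) \<longlonglongrightarrow> (\<Sum>k. \<Prod>i\<le>k. \<rho>)"
  proof (rule tannerys_theorem[THEN conjunct2, THEN conjunct2])
    show "(\<lambda>n. \<Prod>i\<le>k. (real (m n) - real i) / x n) \<longlonglongrightarrow> (\<Prod>i\<le>k. \<rho>)" for k
    proof (intro tendsto_prod)
      fix i
      have "(\<lambda>n. real i / x n) \<longlonglongrightarrow> 0"
        by (rule real_tendsto_divide_at_top[OF tendsto_const x])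
      from tendsto_diff[OF lim this] show "(\<lambda>n. (real (m n) - real i) / x n) \<longlonglongrightarrow> \<rho>"
        by (simp add: diff_divide_distrib)
    qed
    have bound: "norm (\<Prod>i\<le>k. (real (m n) - real i) / x n) \<le> \<sigma> ^ Suc k"
      if n: "x n > 0 \<and> real (m n) / x n \<le> \<sigma>" for n k
    proof (cases "k < m n")
      case True
      have "norm (\<Prod>i\<le>k. (real (m n) - real i) / x n) = (\<Prod>i\<le>k. norm ((real (m n) - real i) / x n))"
        by (simp only: prod_norm)
      also have "\<dots> \<le> (\<Prod>i\<le>k. \<sigma>)"
      proof (intro prod_mono conjI norm_ge_zero)
        fix i assume "i \<in> {..k}"
        then have "norm ((real (m n) - real i) / x n) \<le> real (m n) / x n"
          using True n by (auto simp: divide_simps)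
        then show "norm ((real (m n) - real i) / x n) \<le> \<sigma>" using n by linarith
      qed
      finally show ?thesis by simp
    next
      \<comment> \<open>Factors with \<open>i\<close> beyond \<open>m n\<close> are negative and may
        be large in absolute value, but such a product also contains the zero factor
        \<open>i = m n\<close>.\<close>
      case False
      then have "(\<Prod>i\<le>k. (real (m n) - real i) / x n) = 0" by (intro prod_zero) auto
      then show ?thesis using \<sigma> by (simp only: norm_zero zero_le_power less_imp_le)
    qed
    show "eventually (\<lambda>(k, n). norm (\<Prod>i\<le>k. (real (m n) - real i) / x n) \<le> \<sigma> ^ Suc k) (at_top \<times>\<^sub>F sequentially)"
      unfolding eventually_prod_filter
      by (intro exI[of _ "\<lambda>_. True"] exI[of _ "\<lambda>n. x n > 0 \<and> real (m n) / x n \<le> \<sigma>"] conjI ev)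
        (use bound in auto)
    show "summable (\<lambda>k. \<sigma> ^ Suc k)"
      using \<sigma> by (simp add: summable_geometric)
  qed simp
  also have "(\<Sum>k. \<Prod>i\<le>k. \<rho>) = \<rho> / (1 - \<rho>)"
    using assms suminf_geometric[of \<rho>] by (simp add: suminf_mult summable_geometric)
  finally show ?thesis
    by (rule Lim_transform_eventually)
      (use ev in \<open>auto elim!: eventually_mono simp only: sum_exp_coeffs_eq\<close>)
qed

text \<open>The remainder of the linearized logarithm is at most \<open>2 * u^2\<close>. It serves
  both for the expansion at scale \<open>L\<close> and, with \<open>L n = n\<close>, for the limit
  of \<open>(1 - p n) ^ n\<close>.\<close>

lemma mult_ln_one_plus_remainder_tendsto_0:
  fixes L u :: "nat \<Rightarrow> real"
  assumes "u \<longlonglongrightarrow> 0" "(\<lambda>n. L n * u n ^ 2) \<longlonglongrightarrow> 0"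
  shows "(\<lambda>n. L n * (ln (1 + u n) - u n)) \<longlonglongrightarrow> 0"
proof (rule tendsto_rabs_zero_cancel, rule real_tendsto_sandwich[OF _ _ tendsto_const])
  have "eventually (\<lambda>n. \<bar>u n\<bar> < 1 / 2) sequentially"
    using tendstoD[OF assms(1), of "1 / 2"] by (simp add: dist_real_def)
  then show "\<forall>\<^sub>F n in sequentially. \<bar>L n * (ln (1 + u n) - u n)\<bar> \<le> 2 * \<bar>L n * u n ^ 2\<bar>"
  proof eventually_elim
    case (elim n)
    then have "\<bar>ln (1 + u n) - u n\<bar> \<le> 2 * u n ^ 2"
      by (intro abs_ln_one_plus_x_minus_x_bound) auto
    then have "\<bar>L n\<bar> * \<bar>ln (1 + u n) - u n\<bar> \<le> \<bar>L n\<bar> * (2 * u n ^ 2)"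
      by (intro mult_left_mono) auto
    then show ?case by (simp add: abs_mult)
  qed
  show "(\<lambda>n. 2 * \<bar>L n * u n ^ 2\<bar>) \<longlonglongrightarrow> 0"
    using tendsto_mult[OF tendsto_const[of 2] tendsto_rabs_zero[OF assms(2)]] by simp
qed auto

text \<open>Here \<open>L\<close> stands for \<open>ln n\<close>. The Poisson weight at
  \<open>m\<close> is evaluated through its logarithm by Stirling's formula, and the tail is that
  weight times a ratio tending to \<open>\<beta> / (\<alpha> - \<beta>)\<close>.\<close>

lemma poisson_lower_tail_asymp:
  fixes \<alpha> \<beta> y :: real and m :: "nat \<Rightarrow> nat" and b L lam :: "nat \<Rightarrow> real"
  assumes \<beta>: "\<beta> > 0" and \<alpha>: "\<alpha> > \<beta>" "\<alpha> - \<beta> * ln \<alpha> = \<beta> - \<beta> * ln \<beta> + 1"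
    and m: "eventually (\<lambda>n. real (m n) = \<beta> * L n + b n * L n) sequentially"
    and b: "(\<lambda>n. b n * sqrt (L n)) \<longlonglongrightarrow> 0"
    and L: "filterlim L at_top sequentially"
    and lam: "\<And>n. lam n = \<alpha> * L n + \<alpha> * (\<alpha> - \<beta> - 1) / (\<beta> * (\<alpha> - \<beta>)) * b n * L n
      - \<alpha> / (2 * (\<alpha> - \<beta>)) * ln (L n) + \<alpha> / (\<alpha> - \<beta>) * y"
  shows "filterlim lam at_top sequentially" (is ?top)
    and "(\<lambda>n. exp (L n) * (exp (- lam n) * (\<Sum>r<m n. lam n ^ r / fact r)))
      \<longlonglongrightarrow> sqrt \<beta> / (sqrt (2 * pi) * (\<alpha> - \<beta>)) * exp (- y)" (is ?tail)
proof -
  \<comment> \<open>Relative deviations from the leading orders: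
    \<open>m = \<beta> * L * (1 + v)\<close> and \<open>lam = \<alpha> * L * (1 + u)\<close>, both
    eventually.\<close>
  define v where "v = (\<lambda>n. b n / \<beta>)"
  define u where "u = (\<lambda>n. (\<alpha> - \<beta> - 1) / (\<beta> * (\<alpha> - \<beta>)) * b n - ln (L n) / L n / (2 * (\<alpha> - \<beta>)) + y / L n / (\<alpha> - \<beta>))"
  have lim_compose: "(\<lambda>n. f (L n)) \<longlonglongrightarrow> c" if "(f \<longlongrightarrow> c) at_top" for f :: "real \<Rightarrow> real" and c
    using filterlim_compose[OF that L] .
  have L0: "eventually (\<lambda>n. L n > 0) sequentially"
    using L by (simp add: filterlim_at_top_dense)
  have sqv: "(\<lambda>n. v n * sqrt (L n)) \<longlonglongrightarrow> 0"
    using tendsto_divide[OF b tendsto_const[of \<beta>]] \<beta> by (simp add: v_def)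
  have "(\<lambda>n. (\<alpha> - \<beta> - 1) / (\<beta> * (\<alpha> - \<beta>)) * (b n * sqrt (L n)) - ln (L n) / sqrt (L n) / (2 * (\<alpha> - \<beta>)) + y / sqrt (L n) / (\<alpha> - \<beta>))
     \<longlonglongrightarrow> (\<alpha> - \<beta> - 1) / (\<beta> * (\<alpha> - \<beta>)) * 0 - 0 / (2 * (\<alpha> - \<beta>)) + 0 / (\<alpha> - \<beta>)"
    using \<alpha> by (intro tendsto_intros b lim_compose[of "\<lambda>x. ln x / sqrt x"] lim_compose[of "\<lambda>x. y / sqrt x"]) (simp_all, real_asymp+)
  moreover have "eventually (\<lambda>n. (\<alpha> - \<beta> - 1) / (\<beta> * (\<alpha> - \<beta>)) * (b n * sqrt (L n)) - ln (L n) / sqrt (L n) / (2 * (\<alpha> - \<beta>)) + y / sqrt (L n) / (\<alpha> - \<beta>) = u n * sqrt (L n)) sequentially"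
    using L0
  proof eventually_elim
    case (elim n)
    then have "sqrt (L n) / L n = 1 / sqrt (L n)"
      by (simp add: real_div_sqrt field_simps)
    then have sq: "c / L n * sqrt (L n) = c / sqrt (L n)" for c
      using elim by (simp add: field_simps)
    have "c / L n / d * sqrt (L n) = c / sqrt (L n) / d" for c d
      using sq[of c] by (metis times_divide_eq_left)
    then show ?case by (simp only: u_def distrib_right left_diff_distrib mult.assoc)
  qed
  ultimately have squ: "(\<lambda>n. u n * sqrt (L n)) \<longlonglongrightarrow> 0"
    by (simp add: Lim_transform_eventually)
  have isq: "(\<lambda>n. 1 / sqrt (L n)) \<longlonglongrightarrow> 0"
    by (rule lim_compose) real_asymp
  have small: "w \<longlonglongrightarrow> 0" if "(\<lambda>n. w n * sqrt (L n)) \<longlonglongrightarrow> 0" for w :: "nat \<Rightarrow> real"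
  proof -
    have "(\<lambda>n. (w n * sqrt (L n)) * (1 / sqrt (L n))) \<longlonglongrightarrow> 0"
      by (intro tendsto_mult_zero that isq)
    then show ?thesis
      by (rule Lim_transform_eventually) (use L0 in \<open>auto elim!: eventually_mono\<close>)
  qed
  \<comment> \<open>The reason for requiring \<open>b\<close> to be smaller than
    \<open>1 / sqrt L\<close>: products of two deviations of this size remain negligible after
    multiplication by \<open>L\<close>.\<close>
  have prod_small: "(\<lambda>n. L n * (w n * z n)) \<longlonglongrightarrow> 0"
    if "(\<lambda>n. w n * sqrt (L n)) \<longlonglongrightarrow> 0" "(\<lambda>n. z n * sqrt (L n)) \<longlonglongrightarrow> 0" for w z :: "nat \<Rightarrow> real"
  proof -
    have "(\<lambda>n. (w n * sqrt (L n)) * (z n * sqrt (L n))) \<longlonglongrightarrow> 0"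
      using tendsto_mult[OF that] by simp
    then show ?thesis
      by (rule Lim_transform_eventually) (use L0 in \<open>auto elim!: eventually_mono simp: algebra_simps\<close>)
  qed
  have u0: "u \<longlonglongrightarrow> 0" and v0: "v \<longlonglongrightarrow> 0" using small squ sqv by auto
  have ru: "(\<lambda>n. L n * (ln (1 + u n) - u n)) \<longlonglongrightarrow> 0"
    using prod_small[OF squ squ] by (intro mult_ln_one_plus_remainder_tendsto_0 u0) (simp add: power2_eq_square)
  have rv: "(\<lambda>n. L n * (ln (1 + v n) - v n)) \<longlonglongrightarrow> 0"
    using prod_small[OF sqv sqv] by (intro mult_ln_one_plus_remainder_tendsto_0 v0) (simp add: power2_eq_square)
  have Lu: "u n * L n = (\<alpha> - \<beta> - 1) / (\<beta> * (\<alpha> - \<beta>)) * (b n * L n) - ln (L n) / (2 * (\<alpha> - \<beta>)) + y / (\<alpha> - \<beta>)"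
    if "L n > 0" for n
  proof -
    have "c / L n / d * L n = c / d" for c d using that by simp
    then show ?thesis by (simp only: u_def distrib_right left_diff_distrib mult.assoc)
  qed
  have lam_eq: "eventually (\<lambda>n. lam n = \<alpha> * L n * (1 + u n)) sequentially"
    using L0
  proof eventually_elim
    case (elim n)
    have "\<alpha> * L n * (1 + u n) = \<alpha> * L n + \<alpha> * (u n * L n)" by (simp add: algebra_simps)
    also have "\<dots> = lam n"
      unfolding Lu[OF elim] lam by (simp add: distrib_left right_diff_distrib)
    finally show ?case ..
  qed
  have m_eq: "eventually (\<lambda>n. real (m n) = \<beta> * L n * (1 + v n)) sequentially"
    using m by eventually_elim (use \<beta> in \<open>simp add: v_def field_simps\<close>)
  have "filterlim (\<lambda>n. \<alpha> * (1 + u n) * L n) at_top sequentially"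
  proof (rule filterlim_tendsto_pos_mult_at_top[OF _ _ L])
    show "(\<lambda>n. \<alpha> * (1 + u n)) \<longlonglongrightarrow> \<alpha> * (1 + 0)" by (intro tendsto_intros u0)
  qed (use \<alpha> \<beta> in auto)
  then show top: ?top
    by (rule filterlim_mono_eventually) (use lam_eq in \<open>auto elim!: eventually_mono simp: algebra_simps\<close>)
  have mtop: "filterlim m at_top sequentially"
  proof -
    have "filterlim (\<lambda>n. \<beta> * (1 + v n) * L n) at_top sequentially"
    proof (rule filterlim_tendsto_pos_mult_at_top[OF _ _ L])
      show "(\<lambda>n. \<beta> * (1 + v n)) \<longlonglongrightarrow> \<beta> * (1 + 0)" by (intro tendsto_intros v0)
    qed (use \<beta> in auto)
    then have "filterlim (\<lambda>n. real (m n)) at_top sequentially"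
      by (rule filterlim_mono_eventually) (use m_eq in \<open>auto elim!: eventually_mono simp: algebra_simps\<close>)
    then show ?thesis by (simp only: filterlim_sequentially_iff_filterlim_real)
  qed
  have u1: "eventually (\<lambda>n. 1 + u n > 0) sequentially" and v1: "eventually (\<lambda>n. 1 + v n > 0) sequentially"
    using order_tendstoD(1)[OF u0, of "-1"] order_tendstoD(1)[OF v0, of "-1"] by (auto elim: eventually_mono)
  have ratio: "(\<lambda>n. real (m n) / lam n) \<longlonglongrightarrow> \<beta> / \<alpha>"
  proof -
    have "(\<lambda>n. (\<beta> * (1 + v n)) / (\<alpha> * (1 + u n))) \<longlonglongrightarrow> (\<beta> * (1 + 0)) / (\<alpha> * (1 + 0))"
      using \<alpha> \<beta> by (intro tendsto_intros u0 v0) auto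
    moreover have "eventually (\<lambda>n. (\<beta> * (1 + v n)) / (\<alpha> * (1 + u n)) = real (m n) / lam n) sequentially"
      using m_eq lam_eq L0 by eventually_elim simp
    ultimately show ?thesis by (simp add: Lim_transform_eventually)
  qed
  have tail_ratio: "(\<lambda>n. (\<Sum>r<m n. lam n ^ r / fact r) / (lam n ^ m n / fact (m n))) \<longlonglongrightarrow> (\<beta> / \<alpha>) / (1 - \<beta> / \<alpha>)"
    using \<alpha> \<beta> by (intro sum_exp_coeffs_ratio top ratio) auto
  \<comment> \<open>\<open>st\<close> is the Stirling error. \<open>R\<close> is the second-order
    remainder in \<open>L * (1 + v) * (ln (1 + u) - ln (1 + v)) = L * (u - v) + R\<close>.\<close>
  define st where "st = (\<lambda>n. ln (fact n) - ((real n + 1/2) * ln (real n) - real n))"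
  define R where "R = (\<lambda>n. (1 + v n) * (L n * (ln (1 + u n) - u n) - L n * (ln (1 + v n) - v n)) + L n * (v n * u n) - L n * (v n * v n))"
  have st: "(\<lambda>n. st (m n)) \<longlonglongrightarrow> ln (2 * pi) / 2"
    using filterlim_compose[OF ln_fact_stirling mtop] by (simp add: st_def)
  have "R \<longlonglongrightarrow> (1 + 0) * (0 - 0) + 0 - 0"
    unfolding R_def by (intro tendsto_intros u0 v0 ru rv prod_small squ sqv)
  then have R0: "R \<longlonglongrightarrow> 0" by simp
  have "(\<lambda>n. exp (- y - ln \<beta> / 2 + \<beta> * R n - ln (1 + v n) / 2 - st (m n)))
     \<longlonglongrightarrow> exp (- y - ln \<beta> / 2 + \<beta> * 0 - ln (1 + 0) / 2 - ln (2 * pi) / 2)"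
    by (intro tendsto_intros R0 v0 st) auto
  also have "exp (- y - ln \<beta> / 2 + \<beta> * 0 - ln (1 + 0) / 2 - ln (2 * pi) / 2) = exp (- y) / (sqrt \<beta> * sqrt (2 * pi))"
    using \<beta> by (simp add: exp_diff ln_sqrt[symmetric])
  finally have main: "(\<lambda>n. exp (- y - ln \<beta> / 2 + \<beta> * R n - ln (1 + v n) / 2 - st (m n)))
     \<longlonglongrightarrow> exp (- y) / (sqrt \<beta> * sqrt (2 * pi))" .
  have main_eq: "eventually (\<lambda>n. exp (- y - ln \<beta> / 2 + \<beta> * R n - ln (1 + v n) / 2 - st (m n)) =
      exp (L n) * (exp (- lam n) * (lam n ^ m n / fact (m n)))) sequentially"
    using L0 u1 v1 lam_eq m_eq
  proof eventually_elim
    case (elim n)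
    have \<alpha>0: "\<alpha> > 0" using \<alpha> \<beta> by simp
    have lam0: "lam n > 0" and m0: "real (m n) > 0"
      using elim \<alpha>0 \<beta> by simp_all
    have lnlam: "ln (lam n) = ln \<alpha> + ln (L n) + ln (1 + u n)"
      unfolding elim(4) using elim \<alpha>0 by (simp add: ln_mult)
    have lnm: "ln (real (m n)) = ln \<beta> + ln (L n) + ln (1 + v n)"
      unfolding elim(5) using elim \<beta> by (simp add: ln_mult)
    have "ln (exp (L n) * (exp (- lam n) * (lam n ^ m n / fact (m n)))) = L n - lam n + m n * ln (lam n) - ln (fact (m n))"
      using lam0 by (simp add: ln_mult ln_div ln_realpow)
    also have "\<dots> = L n - lam n + m n * (ln (lam n) - ln (m n)) + m n - ln (m n) / 2 - st (m n)"
      by (simp add: st_def algebra_simps)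
    also have "\<dots> = L n - \<alpha> * L n * (1 + u n) + \<beta> * L n * (1 + v n) * (ln \<alpha> - ln \<beta> + ln (1 + u n) - ln (1 + v n))
        + \<beta> * L n * (1 + v n) - (ln \<beta> + ln (L n) + ln (1 + v n)) / 2 - st (m n)"
      unfolding lnlam lnm unfolding elim(4,5) by simp
    also have "\<dots> = L n - \<alpha> * L n * (1 + u n) + L n * (1 + v n) * (\<beta> * ln \<alpha> - \<beta> * ln \<beta>) + \<beta> * (L n * (u n - v n) + R n)
        + \<beta> * L n * (1 + v n) - (ln \<beta> + ln (L n) + ln (1 + v n)) / 2 - st (m n)"
      by (simp add: R_def algebra_simps)
    \<comment> \<open>The defining equation of \<alpha>. With it the terms of order \<open>L\<close>
      free of \<open>u\<close> and \<open>v\<close> add up to zero.\<close>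
    also have "\<beta> * ln \<alpha> - \<beta> * ln \<beta> = \<alpha> - \<beta> - 1" using \<alpha> by simp
    also have "L n - \<alpha> * L n * (1 + u n) + L n * (1 + v n) * (\<alpha> - \<beta> - 1) + \<beta> * (L n * (u n - v n) + R n)
        + \<beta> * L n * (1 + v n) - (ln \<beta> + ln (L n) + ln (1 + v n)) / 2 - st (m n)
        = - ((\<alpha> - \<beta>) * (L n * u n)) + (\<alpha> - \<beta> - 1) * (L n * v n) + \<beta> * R n - (ln \<beta> + ln (L n) + ln (1 + v n)) / 2 - st (m n)"
      by (simp add: algebra_simps)
    \<comment> \<open>The corrections in \<open>lam\<close> are made for this identity: the one in
      \<open>b\<close> offsets the first-order effect of \<open>v\<close>, and the one in
      \<open>ln L\<close> offsets the \<open>- ln L / 2\<close> from Stirling's formula. Only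
      \<open>- y\<close> survives.\<close>
    also have "(\<alpha> - \<beta>) * (L n * u n) = (\<alpha> - \<beta> - 1) * (L n * v n) - ln (L n) / 2 + y"
    proof -
      have "d * (k / (\<beta> * d) * z - x / (2 * d) + y / d) = k * (z / \<beta>) - x / 2 + y" if "d > 0" for d k x z
        using that \<beta> by (simp add: field_simps)
      from this[of "\<alpha> - \<beta>"] show ?thesis
        using Lu[OF elim(1)] \<alpha>(1) by (simp add: v_def mult.commute[of "L n"])
    qed
    finally have "ln (exp (L n) * (exp (- lam n) * (lam n ^ m n / fact (m n)))) = - y - ln \<beta> / 2 + \<beta> * R n - ln (1 + v n) / 2 - st (m n)"
      by (simp add: field_simps)
    then show ?case using lam0 by (metis exp_ln exp_gt_zero mult_pos_pos divide_pos_pos zero_less_power fact_gt_zero)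
  qed
  from main main_eq have main': "(\<lambda>n. exp (L n) * (exp (- lam n) * (lam n ^ m n / fact (m n)))) \<longlonglongrightarrow> exp (- y) / (sqrt \<beta> * sqrt (2 * pi))"
    by (rule Lim_transform_eventually)
  have "(\<lambda>n. exp (L n) * (exp (- lam n) * (lam n ^ m n / fact (m n))) * ((\<Sum>r<m n. lam n ^ r / fact r) / (lam n ^ m n / fact (m n))))
     \<longlonglongrightarrow> exp (- y) / (sqrt \<beta> * sqrt (2 * pi)) * ((\<beta> / \<alpha>) / (1 - \<beta> / \<alpha>))"
    by (intro tendsto_mult main' tail_ratio)
  also have "exp (- y) / (sqrt \<beta> * sqrt (2 * pi)) * ((\<beta> / \<alpha>) / (1 - \<beta> / \<alpha>)) = sqrt \<beta> / (sqrt (2 * pi) * (\<alpha> - \<beta>)) * exp (- y)"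
  proof -
    have rho: "(\<beta> / \<alpha>) / (1 - \<beta> / \<alpha>) = sqrt \<beta> * sqrt \<beta> / (\<alpha> - \<beta>)"
      using \<alpha> \<beta> by (simp add: field_simps)
    have cancel: "e / (s * p) * (s * s / d) = s / (p * d) * e" if "s \<noteq> 0" for e s p d :: real
      using that by simp
    show ?thesis
      unfolding rho using \<beta> by (intro cancel) simp
  qed
  finally show ?tail
  proof (rule Lim_transform_eventually)
    have "eventually (\<lambda>n. lam n > 0) sequentially"
      using top by (simp add: filterlim_at_top_dense)
    then show "eventually (\<lambda>n. exp (L n) * (exp (- lam n) * (lam n ^ m n / fact (m n))) * ((\<Sum>r<m n. lam n ^ r / fact r) / (lam n ^ m n / fact (m n)))
      = exp (L n) * (exp (- lam n) * (\<Sum>r<m n. lam n ^ r / fact r))) sequentially"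
      by eventually_elim simp
  qed
qed

section \<open>Poissonization\<close>

text \<open>The positions form an arbitrary set \<open>I\<close>, not just \<open>{..<t}\<close>, so
  that an induction over the coupons can delete those taken by one coupon. Extensional functions
  make each outcome sequence count once.\<close>

definition collections :: "nat \<Rightarrow> 'b set \<Rightarrow> 'c set \<Rightarrow> ('c \<Rightarrow> 'b) set" where
  "collections m A I = {f \<in> I \<rightarrow>\<^sub>E A. \<forall>j\<in>A. m \<le> card {i \<in> I. f i = j}}"

lemma finite_collections: "finite A \<Longrightarrow> finite I \<Longrightarrow> finite (collections m A I)"
  unfolding collections_def by (rule finite_subset[of _ "I \<rightarrow>\<^sub>E A"]) (auto intro: finite_PiE)

text \<open>Forgetting the positions \<open>S\<close> of coupon \<open>x\<close> and refilling them
  with \<open>x\<close> are mutually inverse; \<open>m \<le> card S\<close> ensures that refilling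
  yields enough copies of \<open>x\<close>.\<close>

lemma card_collections_fibre:
  assumes "x \<notin> A" "S \<subseteq> I" "m \<le> card S"
  shows "card {f \<in> collections m (insert x A) I. {i \<in> I. f i = x} = S} = card (collections m A (I - S))"
proof (rule bij_betw_same_card[of "\<lambda>f. restrict f (I - S)"],
    rule bij_betw_byWitness[where f' = "\<lambda>g i. if i \<in> S then x else g i"])
  show "\<forall>f\<in>{f \<in> collections m (insert x A) I. {i \<in> I. f i = x} = S}.
      (\<lambda>i. if i \<in> S then x else restrict f (I - S) i) = f"
    by (auto simp: collections_def PiE_def extensional_def fun_eq_iff)
  show "\<forall>g\<in>collections m A (I - S). restrict (\<lambda>i. if i \<in> S then x else g i) (I - S) = g"
    by (auto simp: collections_def PiE_def extensional_def fun_eq_iff)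
  show "(\<lambda>f. restrict f (I - S)) ` {f \<in> collections m (insert x A) I. {i \<in> I. f i = x} = S} \<subseteq> collections m A (I - S)"
  proof clarify
    fix f assume f: "f \<in> collections m (insert x A) I" and S: "S = {i \<in> I. f i = x}"
    have "{i \<in> I - S. restrict f (I - S) i = j} = {i \<in> I. f i = j}" if "j \<in> A" for j
      using that S \<open>x \<notin> A\<close> by auto
    then show "restrict f (I - {i \<in> I. f i = x}) \<in> collections m A (I - {i \<in> I. f i = x})"
      using f S by (auto simp: collections_def PiE_iff)
  qed
  show "(\<lambda>g i. if i \<in> S then x else g i) ` collections m A (I - S) \<subseteq> {f \<in> collections m (insert x A) I. {i \<in> I. f i = x} = S}"
  proof clarify
    fix g assume g: "g \<in> collections m A (I - S)"
    let ?f = "\<lambda>i. if i \<in> S then x else g i"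
    have fx: "{i \<in> I. ?f i = x} = S"
      using g assms by (auto simp: collections_def PiE_iff)
    have fj: "{i \<in> I. ?f i = j} = {i \<in> I - S. g i = j}" if "j \<in> A" for j
      using that assms by auto
    have "?f \<in> I \<rightarrow>\<^sub>E insert x A"
      using g assms by (auto simp: collections_def PiE_iff extensional_def)
    then show "?f \<in> collections m (insert x A) I \<and> {i \<in> I. ?f i = x} = S"
      using g assms fx fj by (auto simp: collections_def)
  qed
qed

text \<open>The exponential generating function of the position sets of a single coupon, which must
  have at least \<open>m\<close> elements.\<close>

definition exp_tail_fps :: "nat \<Rightarrow> real fps" where
  "exp_tail_fps m = fps_exp 1 - fps_of_poly (\<Sum>r<m. monom (1 / fact r) r)"

lemma exp_tail_fps_nth: "fps_nth (exp_tail_fps m) r = (if r < m then 0 else 1 / fact r)"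
  by (simp add: exp_tail_fps_def coeff_sum sum.delta)

lemma fps_conv_radius_exp_tail: "fps_conv_radius (exp_tail_fps m) = \<infinity>"
  using fps_conv_radius_diff[of "fps_exp (1::real)" "fps_of_poly (\<Sum>r<m. monom (1 / fact r) r)"]
  by (simp add: exp_tail_fps_def)

lemma eval_exp_tail_fps: "eval_fps (exp_tail_fps m) x = exp x - (\<Sum>r<m. x ^ r / fact r)"
  unfolding exp_tail_fps_def by (subst eval_fps_diff) (auto simp: poly_sum poly_monom)

text \<open>Adding a coupon means choosing its position set and completing the rest. This is a
  binomial convolution of counts, that is, a product of exponential generating functions.\<close>

lemma card_collections:
  assumes "finite A" "finite I"
  shows "real (card (collections m A I)) = fact (card I) * fps_nth (exp_tail_fps m ^ card A) (card I)"
  using assms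
proof (induction A arbitrary: I rule: finite_induct)
  case empty
  then show ?case
    by (cases "I = {}") (auto simp: collections_def PiE_eq_empty_iff card_eq_0_iff)
next
  case (insert x A)
  let ?F = "exp_tail_fps m"
  have "collections m (insert x A) I =
      (\<Union>S\<in>{S\<in>Pow I. m \<le> card S}. {f \<in> collections m (insert x A) I. {i \<in> I. f i = x} = S})"
    by (auto simp: collections_def)
  also have "card \<dots> = (\<Sum>S\<in>{S\<in>Pow I. m \<le> card S}. card {f \<in> collections m (insert x A) I. {i \<in> I. f i = x} = S})"
    using insert finite_collections[of "insert x A" I m] by (intro card_UN_disjoint) auto
  also have "\<dots> = (\<Sum>S\<in>{S\<in>Pow I. m \<le> card S}. card (collections m A (I - S)))"
    using insert by (intro sum.cong refl card_collections_fibre) auto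
  finally have "real (card (collections m (insert x A) I)) =
      (\<Sum>S\<in>{S\<in>Pow I. m \<le> card S}. real (card (collections m A (I - S))))"
    by simp
  also have "\<dots> = (\<Sum>S\<in>Pow I. if m \<le> card S then real (card (collections m A (I - S))) else 0)"
    using insert by (intro sum.inter_filter) auto
  \<comment> \<open>The condition on \<open>card S\<close> moves into the coefficient of
    \<open>exp_tail_fps m\<close>, which is zero below \<open>m\<close>. The summand now depends on
    \<open>S\<close> only through its size.\<close>
  also have "\<dots> = (\<Sum>S\<in>Pow I. fact (card S) * fps_nth ?F (card S) * (fact (card I - card S) * fps_nth (?F ^ card A) (card I - card S)))"
    using insert by (intro sum.cong refl) (auto simp: exp_tail_fps_nth card_Diff_subset finite_subset)
  also have "\<dots> = (\<Sum>r\<le>card I. \<Sum>S\<in>{S\<in>Pow I. card S = r}. fact (card S) * fps_nth ?F (card S) * (fact (card I - card S) * fps_nth (?F ^ card A) (card I - card S)))"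
    using insert by (intro sum.group[symmetric]) (auto intro: card_mono)
  also have "\<dots> = (\<Sum>r\<le>card I. real (card I choose r) * (fact r * fps_nth ?F r * (fact (card I - r) * fps_nth (?F ^ card A) (card I - r))))"
    using insert by (intro sum.cong refl) (simp add: n_subsets)
  also have "\<dots> = (\<Sum>r\<le>card I. fact (card I) * (fps_nth ?F r * fps_nth (?F ^ card A) (card I - r)))"
    by (intro sum.cong refl) (simp add: binomial_fact)
  also have "\<dots> = fact (card I) * fps_nth (?F ^ card (insert x A)) (card I)"
    using insert by (simp add: fps_mult_nth sum_distrib_left atLeast0AtMost)
  finally show ?case .
qed

text \<open>The series is \<open>exp (- s)\<close> times the generating function at
  \<open>s / card A\<close>. Splitting \<open>exp (- s)\<close> evenly over the
  \<open>card A\<close> factors makes each factor the probability that a Poisson variable is at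
  least \<open>m\<close>.\<close>

lemma poissonization:
  fixes s :: real
  assumes "finite A" "A \<noteq> {}"
  shows "(\<lambda>t. card (collections m A {..<t}) / real (card A) ^ t * (exp (- s) * s ^ t / fact t)) sums
      ((1 - exp (- s / card A) * (\<Sum>r<m. (s / card A) ^ r / fact r)) ^ card A)"
proof -
  define k where "k = card A"
  have k: "k > 0" using assms by (simp add: k_def card_gt_0_iff)
  let ?x = "s / k"
  have "(\<lambda>t. fps_nth (exp_tail_fps m ^ k) t * ?x ^ t) sums eval_fps (exp_tail_fps m ^ k) ?x"
    using fps_conv_radius_power[of "exp_tail_fps m" k]
    by (intro sums_eval_fps) (simp add: fps_conv_radius_exp_tail)
  then have "(\<lambda>t. exp (- s) * (fps_nth (exp_tail_fps m ^ k) t * ?x ^ t)) sums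
      (exp (- s) * (exp ?x - (\<Sum>r<m. ?x ^ r / fact r)) ^ k)"
    by (intro sums_mult) (simp add: eval_fps_power eval_exp_tail_fps fps_conv_radius_exp_tail)
  moreover have "exp (- s) = exp (- ?x) ^ k"
    using k by (simp flip: exp_of_nat_mult)
  then have "exp (- s) * (exp ?x - (\<Sum>r<m. ?x ^ r / fact r)) ^ k = (1 - exp (- ?x) * (\<Sum>r<m. ?x ^ r / fact r)) ^ k"
    by (simp add: right_diff_distrib exp_minus flip: power_mult_distrib)
  moreover have "exp (- s) * (fps_nth (exp_tail_fps m ^ k) t * ?x ^ t) =
      card (collections m A {..<t}) / real k ^ t * (exp (- s) * s ^ t / fact t)" for t
    using assms by (simp add: card_collections k_def power_divide)
  ultimately show ?thesis by (simp add: k_def)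
qed

section \<open>Poisson moments and the transfer from a Poisson to a fixed number of trials\<close>

lemma poisson_sums: "(\<lambda>t. exp (- s) * s ^ t / fact t) sums (1::real)"
  using sums_mult[OF exp_converges[of s], of "exp (- s)"] by (simp add: exp_minus divide_inverse mult_ac)

lemma poisson_mean_sums: "(\<lambda>t. real t * (exp (- s) * s ^ t / fact t)) sums s"
proof -
  have "(\<lambda>t. real (Suc t) * (exp (- s) * s ^ Suc t / fact (Suc t))) sums s"
    using sums_mult[OF poisson_sums[of s], of s] by (simp add: field_simps del: of_nat_Suc)
  then show ?thesis by (subst (asm) sums_Suc_iff) simp
qed

text \<open>A shift of the index absorbs one factor \<open>t\<close> into the weight, as for the
  mean. This gives the second moment \<open>s * (s + 1)\<close>, and expanding the square leaves
  \<open>s\<close>.\<close>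

lemma poisson_variance_sums: "(\<lambda>t. (real t - s)\<^sup>2 * (exp (- s) * s ^ t / fact t)) sums s"
proof -
  have "(\<lambda>t. real (Suc t) ^ 2 * (exp (- s) * s ^ Suc t / fact (Suc t))) sums (s * (s + 1))"
  proof -
    have "(\<lambda>t. s * (real t * (exp (- s) * s ^ t / fact t) + exp (- s) * s ^ t / fact t)) sums (s * (s + 1))"
      by (intro sums_mult sums_add poisson_mean_sums poisson_sums)
    moreover have "s * (real t * (exp (- s) * s ^ t / fact t) + exp (- s) * s ^ t / fact t) =
        real (Suc t) ^ 2 * (exp (- s) * s ^ Suc t / fact (Suc t))" for t
    proof -
      have "real (Suc t) ^ 2 * (exp (- s) * s ^ Suc t / fact (Suc t)) = real (Suc t) * (exp (- s) * s ^ Suc t / fact t)"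
        unfolding fact_Suc by (simp add: power2_eq_square del: of_nat_Suc)
      then show ?thesis by (simp add: field_simps)
    qed
    ultimately show ?thesis by simp
  qed
  then have "(\<lambda>t. real t ^ 2 * (exp (- s) * s ^ t / fact t)) sums (s * (s + 1))"
    by (subst (asm) sums_Suc_iff) simp
  from sums_add[OF sums_diff[OF this sums_mult[OF poisson_mean_sums[of s], of "2 * s"]] sums_mult[OF poisson_sums[of s], of "s\<^sup>2"]]
  show ?thesis
    by (simp add: power2_eq_square algebra_simps add_divide_distrib diff_divide_distrib)
qed

text \<open>Chebyshev's inequality in pointwise form: for every \<open>k\<close>, \<open>f t\<close>
  and \<open>f k\<close> compare in the required direction up to
  \<open>(k - s)^2 / \<delta>^2\<close>. Either monotonicity gives this, or \<open>k\<close> is at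
  least \<delta> away from \<open>s\<close> and the quadratic term exceeds 1. Averaging over the
  Poisson weights turns that term into \<open>s / \<delta>^2\<close>.\<close>

lemma poisson_monotone_bounds:
  fixes f :: "nat \<Rightarrow> real" and s \<delta> Q :: real
  assumes f: "mono f" "\<And>t. 0 \<le> f t" "\<And>t. f t \<le> 1" and s: "s \<ge> 0" and \<delta>: "\<delta> > 0"
    and Q: "(\<lambda>k. f k * (exp (- s) * s ^ k / fact k)) sums Q"
  shows "real t + \<delta> \<le> s \<Longrightarrow> f t \<le> Q + s / \<delta>\<^sup>2"
    and "s + \<delta> \<le> real t \<Longrightarrow> Q - s / \<delta>\<^sup>2 \<le> f t"
proof -
  let ?p = "\<lambda>k. exp (- s) * s ^ k / fact k"
  have p: "?p k \<ge> 0" for k using s by simp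
  have var: "(\<lambda>k. (real k - s)\<^sup>2 * ?p k / \<delta>\<^sup>2) sums (s / \<delta>\<^sup>2)"
    using poisson_variance_sums by (rule sums_divide)
  have one: "(\<lambda>k. f t * ?p k) sums f t"
    using sums_mult[OF poisson_sums, of "f t"] by simp
  have far: "1 \<le> (real k - s)\<^sup>2 / \<delta>\<^sup>2" if "\<delta> \<le> \<bar>real k - s\<bar>" for k
    using power_mono[OF that, of 2] \<delta> by simp
  {
    assume t: "real t + \<delta> \<le> s"
    have le: "f t \<le> f k + (real k - s)\<^sup>2 / \<delta>\<^sup>2" for k
    proof (cases "k < t")
      case True
      then show ?thesis using far[of k] t f(2)[of k] f(3)[of t] by linarith
    next
      case False
      then show ?thesis using monoD[OF f(1), of t k] by (simp add: add_increasing2)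
    qed
    have "f t * ?p k \<le> f k * ?p k + (real k - s)\<^sup>2 * ?p k / \<delta>\<^sup>2" for k
      using mult_right_mono[OF le[of k] p[of k]] by (simp add: algebra_simps)
    then show "f t \<le> Q + s / \<delta>\<^sup>2"
      using one sums_add[OF Q var] by (rule sums_le)
  next
    assume t: "s + \<delta> \<le> real t"
    have le: "f k - (real k - s)\<^sup>2 / \<delta>\<^sup>2 \<le> f t" for k
    proof (cases "t < k")
      case True
      then show ?thesis using far[of k] t f(3)[of k] f(2)[of t] by linarith
    next
      case False
      then show ?thesis using monoD[OF f(1), of k t]
        by (smt (verit) divide_nonneg_nonneg not_less zero_le_power2)
    qed
    have "f k * ?p k - (real k - s)\<^sup>2 * ?p k / \<delta>\<^sup>2 \<le> f t * ?p k" for k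
      using mult_right_mono[OF le[of k] p[of k]] by (simp add: algebra_simps)
    then show "Q - s / \<delta>\<^sup>2 \<le> f t"
      using sums_diff[OF Q var] one by (rule sums_le)
  }
qed

text \<open>Since \<open>p n\<close> tends to 0, so does \<open>n * (p n)^2\<close>, and
  \<open>n * ln (1 - p n)\<close> may be replaced by \<open>- n * p n\<close>.\<close>

lemma one_minus_power_tendsto_exp:
  fixes p :: "nat \<Rightarrow> real"
  assumes "(\<lambda>n. real n * p n) \<longlonglongrightarrow> c"
  shows "(\<lambda>n. (1 - p n) ^ n) \<longlonglongrightarrow> exp (- c)"
proof -
  have "(\<lambda>n. real n * p n * (1 / real n)) \<longlonglongrightarrow> c * 0"
    by (intro tendsto_mult assms lim_1_over_n)
  then have "(\<lambda>n. real n * p n * (1 / real n)) \<longlonglongrightarrow> 0" by simp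
  then have p0: "p \<longlonglongrightarrow> 0"
    by (rule Lim_transform_eventually) (use eventually_gt_at_top[of 0] in \<open>eventually_elim, simp\<close>)
  have "(\<lambda>n. real n * p n * p n) \<longlonglongrightarrow> c * 0"
    by (intro tendsto_mult assms p0)
  then have "(\<lambda>n. real n * (- p n)\<^sup>2) \<longlonglongrightarrow> 0"
    by (simp add: power2_eq_square mult.assoc)
  with tendsto_minus[OF p0] have "(\<lambda>n. real n * (ln (1 + - p n) - - p n)) \<longlonglongrightarrow> 0"
    by (intro mult_ln_one_plus_remainder_tendsto_0) simp_all
  from tendsto_exp[OF tendsto_diff[OF this assms]]
  have "(\<lambda>n. exp (real n * ln (1 - p n))) \<longlonglongrightarrow> exp (- c)"
    by (simp add: algebra_simps)
  moreover have "eventually (\<lambda>n. p n < 1) sequentially"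
    using order_tendstoD(2)[OF p0, of 1] by simp
  then have "eventually (\<lambda>n. exp (real n * ln (1 - p n)) = (1 - p n) ^ n) sequentially"
    by eventually_elim (simp add: exp_of_nat_mult)
  ultimately show ?thesis by (rule Lim_transform_eventually)
qed

section \<open>Completion of the collection in the sampling model\<close>

definition collected :: "nat \<Rightarrow> nat \<Rightarrow> (nat \<Rightarrow> 'a \<Rightarrow> nat) \<Rightarrow> nat \<Rightarrow> 'a \<Rightarrow> bool" where
  "collected m n X t \<omega> \<longleftrightarrow> (\<forall>j\<in>{1..n}. m \<le> card {i. i < t \<and> X i \<omega> = j})"

lemma collected_mono: "collected m n X t \<omega> \<Longrightarrow> t \<le> t' \<Longrightarrow> collected m n X t' \<omega>"
  unfolding collected_def by (fastforce elim!: order_trans intro!: card_mono)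

lemma coupon_time_eq_Least: "coupon_time m n X \<omega> = (LEAST t. collected m n X t \<omega>)"
  by (simp add: coupon_time_def collected_def Inf_nat_def)

context coupon_sampling
begin

lemma measurable_trial [measurable]: "X i \<in> measurable M (count_space UNIV)"
  using indep_trials by (simp add: indep_vars_def2)

lemma measurable_collected [measurable]: "Measurable.pred M (collected m n X t)"
proof -
  \<comment> \<open>A count written as a finite sum of indicators is within reach of the
    measurability prover.\<close>
  have "card {i. i < t \<and> P i} = (\<Sum>i<t. if P i then 1 else 0)" for P :: "nat \<Rightarrow> bool"
    by (simp add: sum.inter_filter[symmetric])
  then have "collected m n X t = (\<lambda>\<omega>. \<forall>j\<in>{1..n}. m \<le> (\<Sum>i<t. if X i \<omega> = j then 1 else 0))"
    by (simp add: collected_def fun_eq_iff)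
  then show ?thesis by simp
qed

lemma measurable_coupon_time [measurable]: "coupon_time m n X \<in> measurable M (count_space UNIV)"
  unfolding coupon_time_eq_Least[abs_def] by measurable

text \<open>The model prescribes only the probabilities of \<open>1..n\<close>; they already add up
  to 1.\<close>

lemma AE_trial_in_range:
  assumes "n \<ge> 1"
  shows "AE \<omega> in M. X i \<omega> \<in> {1..n}"
proof -
  have "prob {\<omega> \<in> space M. X i \<omega> \<in> {1..n}} = prob (\<Union>j\<in>{1..n}. {\<omega> \<in> space M. X i \<omega> = j})"
    by (rule arg_cong[where f = prob]) auto
  also have "\<dots> = (\<Sum>j\<in>{1..n}. prob {\<omega> \<in> space M. X i \<omega> = j})"
    by (rule finite_measure_finite_Union) (auto simp: disjoint_family_on_def)
  also have "\<dots> = 1" using assms by (simp add: uniform_trials)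
  finally show ?thesis by (subst prob_Collect_eq_1[symmetric]) auto
qed

lemma prob_trials_eq:
  assumes "\<And>i. i < t \<Longrightarrow> f i \<in> {1..n}"
  shows "prob {\<omega> \<in> space M. \<forall>i<t. X i \<omega> = f i} = 1 / real n ^ t"
\<comment> \<open>The product rule for independent variables is stated for nonempty index sets, so
  the empty sequence is treated apart.\<close>
proof (cases "t = 0")
  case True
  then show ?thesis by (simp add: prob_space)
next
  case False
  have "{\<omega> \<in> space M. \<forall>i<t. X i \<omega> = f i} = (\<Inter>i\<in>{..<t}. X i -` {f i} \<inter> space M)"
    using False by auto
  also have "prob \<dots> = (\<Prod>i<t. prob (X i -` {f i} \<inter> space M))"
    using False by (intro indep_varsD[OF indep_trials]) auto
  also have "\<dots> = (\<Prod>i<t. 1 / real n)"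
  proof (intro prod.cong refl)
    fix i assume "i \<in> {..<t}"
    then show "prob (X i -` {f i} \<inter> space M) = 1 / real n"
      using uniform_trials[of "f i" i] assms by (simp add: vimage_def Int_def conj_commute)
  qed
  finally show ?thesis by (simp add: power_one_over)
qed

text \<open>Almost surely all trials lie in \<open>1..n\<close>; the event then splits disjointly
  according to the first \<open>t\<close> outcomes, and each sequence has probability
  \<open>1 / n ^ t\<close>.\<close>

lemma prob_collected:
  assumes "n \<ge> 1"
  shows "prob {\<omega> \<in> space M. collected m n X t \<omega>} = card (collections m {1..n} {..<t}) / real n ^ t"
proof -
  let ?C = "collections m {1..n} {..<t}"
  let ?E = "\<lambda>f. {\<omega> \<in> space M. \<forall>i<t. X i \<omega> = f i}"
  have count: "{i. i < t \<and> g i = j} = {i \<in> {..<t}. f i = j}" if "\<And>i. i < t \<Longrightarrow> g i = f i" for f g :: "nat \<Rightarrow> nat" and j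
    using that by auto
  have fin: "finite ?C" by (intro finite_collections) auto
  have "AE \<omega> in M. \<forall>i. X i \<omega> \<in> {1..n}"
    using AE_trial_in_range[OF assms] by (simp add: AE_all_countable)
  then have "prob {\<omega> \<in> space M. collected m n X t \<omega>} = prob (\<Union>f\<in>?C. ?E f)"
  proof (intro measure_eq_AE)
    assume "AE \<omega> in M. \<forall>i. X i \<omega> \<in> {1..n}"
    then show "AE \<omega> in M. \<omega> \<in> {\<omega> \<in> space M. collected m n X t \<omega>} \<longleftrightarrow> \<omega> \<in> (\<Union>f\<in>?C. ?E f)"
    proof eventually_elim
      case (elim \<omega>)
      show ?case
      proof
        assume \<omega>: "\<omega> \<in> {\<omega> \<in> space M. collected m n X t \<omega>}"
        let ?f = "restrict (\<lambda>i. X i \<omega>) {..<t}"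
        have "?f \<in> ?C"
          using \<omega> elim count[of "\<lambda>i. X i \<omega>" ?f] by (auto simp: collected_def collections_def)
        then show "\<omega> \<in> (\<Union>f\<in>?C. ?E f)" using \<omega> by (intro UN_I[of ?f]) auto
      next
        assume "\<omega> \<in> (\<Union>f\<in>?C. ?E f)"
        then obtain f where f: "f \<in> ?C" "\<omega> \<in> ?E f" by blast
        then show "\<omega> \<in> {\<omega> \<in> space M. collected m n X t \<omega>}"
          using count[of "\<lambda>i. X i \<omega>" f] by (auto simp: collected_def collections_def)
      qed
    qed
  qed (use fin in auto)
  also have "\<dots> = (\<Sum>f\<in>?C. prob (?E f))"
  proof (rule finite_measure_finite_Union[OF fin])
    show "disjoint_family_on ?E ?C"
      unfolding disjoint_family_on_def
    proof (intro ballI impI)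
      fix f g assume fg: "f \<in> ?C" "g \<in> ?C" "f \<noteq> g"
      then obtain i where "i < t" "f i \<noteq> g i"
        using PiE_ext[of f "{..<t}" "\<lambda>_. {1..n}" g] by (auto simp: collections_def)
      then show "?E f \<inter> ?E g = {}" by auto
    qed
  qed auto
  also have "\<dots> = (\<Sum>f\<in>?C. 1 / real n ^ t)"
    by (intro sum.cong refl prob_trials_eq) (auto simp: collections_def PiE_iff)
  finally show ?thesis by simp
qed

text \<open>The second time \<open>t'\<close> accounts for the junk value \<open>0\<close> of \<open>coupon_time\<close> on outcomes
  that never complete the collection.\<close>
lemma prob_coupon_time_bounds:
  shows "prob {\<omega> \<in> space M. collected m n X t \<omega>} \<le> prob {\<omega> \<in> space M. coupon_time m n X \<omega> \<le> t}"
    and "prob {\<omega> \<in> space M. coupon_time m n X \<omega> \<le> t} \<le>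
      prob {\<omega> \<in> space M. collected m n X t \<omega>} + (1 - prob {\<omega> \<in> space M. collected m n X t' \<omega>})"
proof -
  let ?E = "\<lambda>t. {\<omega> \<in> space M. collected m n X t \<omega>}"
  show "prob (?E t) \<le> prob {\<omega> \<in> space M. coupon_time m n X \<omega> \<le> t}"
    by (intro finite_measure_mono) (auto simp: coupon_time_eq_Least intro: Least_le)
  have "{\<omega> \<in> space M. coupon_time m n X \<omega> \<le> t} \<subseteq> ?E t \<union> (space M - ?E t')"
  proof clarify
    \<comment> \<open>Completion by \<open>t'\<close> means that the least completion time is
      attained; by monotonicity the collection is then complete at \<open>t\<close>.\<close>
    fix \<omega> assume "coupon_time m n X \<omega> \<le> t" "collected m n X t' \<omega>"
    then show "collected m n X t \<omega>"
      unfolding coupon_time_eq_Least by (metis LeastI collected_mono)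
  qed
  then have "prob {\<omega> \<in> space M. coupon_time m n X \<omega> \<le> t} \<le> prob (?E t \<union> (space M - ?E t'))"
    by (intro finite_measure_mono) auto
  also have "\<dots> \<le> prob (?E t) + prob (space M - ?E t')"
    by (intro measure_Un_le) auto
  also have "prob (space M - ?E t') = 1 - prob (?E t')"
    by (intro prob_compl) auto
  finally show "prob {\<omega> \<in> space M. coupon_time m n X \<omega> \<le> t} \<le> prob (?E t) + (1 - prob (?E t'))" .
qed

text \<open>The comparison at Poisson mean \<open>n * lam\<close> and deviation
  \<open>n * \<delta>\<close>, with error \<open>n * lam / (n * \<delta>)^2\<close>.\<close>

lemma prob_collected_bounds:
  fixes m t :: nat and lam \<delta> :: real
  assumes n: "n \<ge> 1" and lam: "lam \<ge> 0" and \<delta>: "\<delta> > 0"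
  defines "Q \<equiv> (1 - exp (- lam) * (\<Sum>r<m. lam ^ r / fact r)) ^ n"
  shows "real t + real n * \<delta> \<le> real n * lam \<Longrightarrow> prob {\<omega> \<in> space M. collected m n X t \<omega>} \<le> Q + lam / real n / \<delta>\<^sup>2"
    and "real n * lam + real n * \<delta> \<le> real t \<Longrightarrow> Q - lam / real n / \<delta>\<^sup>2 \<le> prob {\<omega> \<in> space M. collected m n X t \<omega>}"
proof -
  let ?q = "\<lambda>t. prob {\<omega> \<in> space M. collected m n X t \<omega>}"
  have "(\<lambda>t. ?q t * (exp (- (real n * lam)) * (real n * lam) ^ t / fact t)) sums Q"
    using poissonization[of "{1..n}" m "real n * lam"] n by (simp add: prob_collected Q_def)
  moreover have "mono ?q"
    by (intro monoI finite_measure_mono) (auto intro: collected_mono)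
  moreover have "real n * lam / (real n * \<delta>)\<^sup>2 = lam / real n / \<delta>\<^sup>2"
    using n by (simp add: power2_eq_square)
  ultimately show "real t + real n * \<delta> \<le> real n * lam \<Longrightarrow> ?q t \<le> Q + lam / real n / \<delta>\<^sup>2"
    and "real n * lam + real n * \<delta> \<le> real t \<Longrightarrow> Q - lam / real n / \<delta>\<^sup>2 \<le> ?q t"
    using poisson_monotone_bounds[of ?q "real n * lam" "real n * \<delta>" Q t] n lam \<delta> by simp_all
qed

end

section \<open>The limit distribution\<close>

text \<open>The equation for \<alpha> is a hypothesis here; the final theorem supplies it from
  unique existence.\<close>

locale coupon_regime =
  fixes \<alpha> \<beta> :: real and m :: "nat \<Rightarrow> nat" and b :: "nat \<Rightarrow> real"
    and M :: "nat \<Rightarrow> 'a measure" and X :: "nat \<Rightarrow> nat \<Rightarrow> 'a \<Rightarrow> nat"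
  assumes beta: "\<beta> > 0"
    and alpha: "\<alpha> > \<beta>" "\<alpha> - \<beta> * ln \<alpha> = \<beta> - \<beta> * ln \<beta> + 1"
    and m: "\<And>n. n \<ge> 2 \<Longrightarrow> real (m n) = \<beta> * ln (real n) + b n * ln (real n)"
    and b: "b \<in> o(\<lambda>n. 1 / sqrt (ln (real n)))"
    and sampling: "\<And>n. n \<ge> 1 \<Longrightarrow> coupon_sampling (M n) n (X n)"
begin

text \<open>\<open>n * lam y n\<close> is the number of trials at which the normalized time of the
  theorem equals \<open>y\<close>; thus \<open>lam y n\<close> is the mean number of copies per
  coupon.\<close>

definition lam :: "real \<Rightarrow> nat \<Rightarrow> real" where
  "lam y n = \<alpha> * ln (real n) + \<alpha> * (\<alpha> - \<beta> - 1) / (\<beta> * (\<alpha> - \<beta>)) * b n * ln (real n)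
    - \<alpha> / (2 * (\<alpha> - \<beta>)) * ln (ln (real n)) + \<alpha> / (\<alpha> - \<beta>) * y"

definition limit_cdf :: "real \<Rightarrow> real" where
  "limit_cdf y = exp (- (sqrt \<beta> / (sqrt (2 * pi) * (\<alpha> - \<beta>)) * exp (- y)))"

text \<open>Integer version of the threshold \<open>n * lam y n\<close>; truncation at 0 affects
  only finitely many \<open>n\<close>, as \<open>lam y\<close> tends to infinity.\<close>

definition trials :: "real \<Rightarrow> nat \<Rightarrow> nat" where
  "trials y n = nat \<lfloor>real n * lam y n\<rfloor>"

definition collected_prob :: "nat \<Rightarrow> nat \<Rightarrow> real" where
  "collected_prob n t = measure (M n) {\<omega> \<in> space (M n). collected (m n) n (X n) t \<omega>}"

lemma b_sqrt: "(\<lambda>n. b n * sqrt (ln (real n))) \<longlonglongrightarrow> 0"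
  using smalloD_tendsto[OF b] by simp

lemma lam_at_top: "filterlim (lam y) at_top sequentially"
  and prob_tail: "(\<lambda>n. real n * (exp (- lam y n) * (\<Sum>r<m n. lam y n ^ r / fact r)))
    \<longlonglongrightarrow> sqrt \<beta> / (sqrt (2 * pi) * (\<alpha> - \<beta>)) * exp (- y)"
proof -
  have ev: "eventually (\<lambda>n. real (m n) = \<beta> * ln (real n) + b n * ln (real n)) sequentially"
    using m by (intro eventually_sequentiallyI[of 2])
  have L: "filterlim (\<lambda>n. ln (real n)) at_top sequentially" by real_asymp
  note tail = poisson_lower_tail_asymp[OF beta alpha ev b_sqrt L lam_def[of y]]
  show "filterlim (lam y) at_top sequentially" by (rule tail)
  show "(\<lambda>n. real n * (exp (- lam y n) * (\<Sum>r<m n. lam y n ^ r / fact r)))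
    \<longlonglongrightarrow> sqrt \<beta> / (sqrt (2 * pi) * (\<alpha> - \<beta>)) * exp (- y)"
    using tail(2) by (rule Lim_transform_eventually)
      (use eventually_gt_at_top[of 0] in \<open>eventually_elim, simp\<close>)
qed

text \<open>Moving \<open>y\<close> by a constant moves the number of trials by order
  \<open>n\<close>, the margin needed for the Chebyshev bound.\<close>

lemma lam_shift: "lam (y + e) n = lam y n + \<alpha> / (\<alpha> - \<beta>) * e"
  by (simp add: lam_def distrib_left)

text \<open>Makes the Chebyshev error vanish for fixed \<delta>. The term in \<open>b\<close> is
  split into \<open>b * sqrt (ln n)\<close> and \<open>sqrt (ln n) / n\<close>, both tending to
  0.\<close>

lemma lam_over_n: "(\<lambda>n. lam y n / real n) \<longlonglongrightarrow> 0"
proof -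
  have "(\<lambda>n. \<alpha> * (ln (real n) / real n) + \<alpha> * (\<alpha> - \<beta> - 1) / (\<beta> * (\<alpha> - \<beta>)) * ((b n * sqrt (ln (real n))) * (sqrt (ln (real n)) / real n))
    - \<alpha> / (2 * (\<alpha> - \<beta>)) * (ln (ln (real n)) / real n) + \<alpha> / (\<alpha> - \<beta>) * y * (1 / real n))
    \<longlonglongrightarrow> \<alpha> * 0 + \<alpha> * (\<alpha> - \<beta> - 1) / (\<beta> * (\<alpha> - \<beta>)) * (0 * 0) - \<alpha> / (2 * (\<alpha> - \<beta>)) * 0 + \<alpha> / (\<alpha> - \<beta>) * y * 0"
    by (intro tendsto_add tendsto_diff tendsto_mult tendsto_const b_sqrt) real_asymp+
  moreover have "eventually (\<lambda>n. \<alpha> * (ln (real n) / real n) + \<alpha> * (\<alpha> - \<beta> - 1) / (\<beta> * (\<alpha> - \<beta>)) * ((b n * sqrt (ln (real n))) * (sqrt (ln (real n)) / real n))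
    - \<alpha> / (2 * (\<alpha> - \<beta>)) * (ln (ln (real n)) / real n) + \<alpha> / (\<alpha> - \<beta>) * y * (1 / real n) = lam y n / real n) sequentially"
    using eventually_gt_at_top[of 0]
  proof eventually_elim
    case (elim n)
    then have "ln (real n) \<ge> 0" by simp
    then have "(b n * sqrt (ln (real n))) * (sqrt (ln (real n)) / real n) = b n * ln (real n) / real n"
      by simp
    note key = this
    have "p * (x / N) + k * (B * x / N) - q * (z / N) + r * y * (1 / N) = (p * x + k * B * x - q * z + r * y) / N"
      for p x k B N q z r :: real
      by (simp add: add_divide_distrib diff_divide_distrib)
    then show ?case unfolding key lam_def .
  qed
  ultimately show ?thesis by (simp add: Lim_transform_eventually)
qed

lemma product_tendsto: "(\<lambda>n. (1 - exp (- lam y n) * (\<Sum>r<m n. lam y n ^ r / fact r)) ^ n) \<longlonglongrightarrow> limit_cdf y"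
  unfolding limit_cdf_def by (rule one_minus_power_tendsto_exp[OF prob_tail])

text \<open>The probability at the threshold for \<open>y\<close> is squeezed between the
  Poissonized ones for \<open>y - e\<close> and \<open>y + e\<close>, up to vanishing errors;
  continuity of \<open>limit_cdf\<close> makes \<open>e\<close> harmless.\<close>

lemma collected_prob_tendsto: "(\<lambda>n. collected_prob n (trials y n)) \<longlonglongrightarrow> limit_cdf y"
proof -
  define \<kappa> where "\<kappa> = \<alpha> / (\<alpha> - \<beta>)"
  have \<kappa>: "\<kappa> > 0" using alpha beta by (simp add: \<kappa>_def)
  let ?Q = "\<lambda>y n. (1 - exp (- lam y n) * (\<Sum>r<m n. lam y n ^ r / fact r)) ^ n"
  have cont: "limit_cdf \<midarrow>y\<rightarrow> limit_cdf y"
  proof -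
    have "isCont limit_cdf y" unfolding limit_cdf_def by (intro continuous_intros)
    then show ?thesis by (simp add: isCont_def)
  qed
  have err: "(\<lambda>n. lam z n / real n / \<delta>\<^sup>2) \<longlonglongrightarrow> 0" for z \<delta>
    using tendsto_mult_left_zero[OF lam_over_n[of z], of "inverse (\<delta>\<^sup>2)"] by (simp add: divide_inverse)
  have pos: "eventually (\<lambda>n. lam z n > 0) sequentially" for z
    using lam_at_top[of z] by (simp add: filterlim_at_top_dense)
  show ?thesis
  proof (rule order_tendstoI)
    fix c assume "c < limit_cdf y"
    then obtain d where d: "d > 0" "\<And>z. z \<noteq> y \<Longrightarrow> dist z y < d \<Longrightarrow> c < limit_cdf z"
      using order_tendstoD(1)[OF cont \<open>c < limit_cdf y\<close>] unfolding eventually_at by auto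
    define e where "e = d / 2"
    have e: "e > 0" "c < limit_cdf (y - e)"
      using d(1) d(2)[of "y - e"] by (auto simp: e_def dist_real_def)
    \<comment> \<open>Half of the available gap: one \<delta> is the Chebyshev margin, and the
      other, times \<open>n\<close>, exceeds 1 and absorbs the loss from rounding down in
      \<open>trials\<close>.\<close>
    define \<delta> where "\<delta> = \<kappa> * e / 2"
    have \<delta>: "\<delta> > 0" using \<kappa> e by (simp add: \<delta>_def)
    have "(\<lambda>n. ?Q (y - e) n - lam (y - e) n / real n / \<delta>\<^sup>2) \<longlonglongrightarrow> limit_cdf (y - e) - 0"
      by (intro tendsto_diff product_tendsto err)
    then have "eventually (\<lambda>n. c < ?Q (y - e) n - lam (y - e) n / real n / \<delta>\<^sup>2) sequentially"
      using e by (intro order_tendstoD(1)) auto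
    moreover have "eventually (\<lambda>n. real n > 1 / \<delta>) sequentially"
      using filterlim_real_sequentially by (simp add: filterlim_at_top_dense)
    ultimately show "eventually (\<lambda>n. c < collected_prob n (trials y n)) sequentially"
      using pos[of y] pos[of "y - e"] eventually_ge_at_top[of 1]
    proof eventually_elim
      case (elim n)
      interpret S: coupon_sampling "M n" n "X n" using elim by (intro sampling)
      have "lam y n = lam (y - e) n + 2 * \<delta>"
        using lam_shift[of "y - e" e n, folded \<kappa>_def] by (simp add: \<delta>_def)
      then have "real n * lam (y - e) n + real n * \<delta> + 1 \<le> real n * lam y n"
        using elim(2) \<delta> by (simp add: field_simps)
      moreover have "real n * lam y n - 1 \<le> real (trials y n)"
        unfolding trials_def by linarith
      ultimately have "real n * lam (y - e) n + real n * \<delta> \<le> real (trials y n)" by linarith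
      from S.prob_collected_bounds(2)[where m = "m n", OF _ _ \<delta> this] elim show ?case
        unfolding collected_prob_def by linarith
    qed
  next
    fix c assume "limit_cdf y < c"
    then obtain d where d: "d > 0" "\<And>z. z \<noteq> y \<Longrightarrow> dist z y < d \<Longrightarrow> limit_cdf z < c"
      using order_tendstoD(2)[OF cont \<open>limit_cdf y < c\<close>] unfolding eventually_at by auto
    define e where "e = d / 2"
    have e: "e > 0" "limit_cdf (y + e) < c"
      using d(1) d(2)[of "y + e"] by (auto simp: e_def dist_real_def)
    \<comment> \<open>The whole gap serves as margin, since rounding down helps in this
      direction.\<close>
    define \<delta> where "\<delta> = \<kappa> * e"
    have \<delta>: "\<delta> > 0" using \<kappa> e by (simp add: \<delta>_def)
    have "(\<lambda>n. ?Q (y + e) n + lam (y + e) n / real n / \<delta>\<^sup>2) \<longlonglongrightarrow> limit_cdf (y + e) + 0"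
      by (intro tendsto_add product_tendsto err)
    then have "eventually (\<lambda>n. ?Q (y + e) n + lam (y + e) n / real n / \<delta>\<^sup>2 < c) sequentially"
      using e by (intro order_tendstoD(2)) auto
    then show "eventually (\<lambda>n. collected_prob n (trials y n) < c) sequentially"
      using pos[of y] pos[of "y + e"] eventually_ge_at_top[of 1]
    proof eventually_elim
      case (elim n)
      interpret S: coupon_sampling "M n" n "X n" using elim by (intro sampling)
      have "lam (y + e) n = lam y n + \<delta>"
        using lam_shift[of y e n, folded \<kappa>_def] by (simp add: \<delta>_def)
      moreover have "real (trials y n) \<le> real n * lam y n"
        unfolding trials_def using elim by simp
      ultimately have "real (trials y n) + real n * \<delta> \<le> real n * lam (y + e) n"
        by (simp add: distrib_left)
      from S.prob_collected_bounds(1)[where m = "m n", OF _ _ \<delta> this] elim show ?case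
        unfolding collected_prob_def by linarith
    qed
  qed
qed

text \<open>Used to bound the probability that the collection is never completed.\<close>

lemma limit_cdf_at_top: "(limit_cdf \<longlongrightarrow> 1) at_top"
proof -
  have "((\<lambda>y. exp (- (c * exp (- y)))) \<longlongrightarrow> exp (- (c * 0))) at_top" for c :: real
    by (intro tendsto_intros) real_asymp
  from this[of "sqrt \<beta> / (sqrt (2 * pi) * (\<alpha> - \<beta>))"] show ?thesis
    unfolding limit_cdf_def by simp
qed

text \<open>The event that the time is at most \<open>t\<close> differs from completion by
  \<open>t\<close> only on outcomes still incomplete at any chosen later threshold; for the
  threshold at \<open>z\<close> their limiting probability is \<open>1 - limit_cdf z\<close>, which
  is small for large \<open>z\<close>.\<close>

lemma coupon_time_tendsto:
  "(\<lambda>n. measure (M n) {\<omega> \<in> space (M n). real (coupon_time (m n) n (X n) \<omega>) \<le> real n * lam y n})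
    \<longlonglongrightarrow> limit_cdf y"
proof -
  let ?T = "\<lambda>n. measure (M n) {\<omega> \<in> space (M n). coupon_time (m n) n (X n) \<omega> \<le> trials y n}"
  have "?T \<longlonglongrightarrow> limit_cdf y"
  proof (rule order_tendstoI)
    fix c assume "c < limit_cdf y"
    from order_tendstoD(1)[OF collected_prob_tendsto this] eventually_ge_at_top[of 1]
    show "eventually (\<lambda>n. c < ?T n) sequentially"
    proof eventually_elim
      case (elim n)
      interpret S: coupon_sampling "M n" n "X n" using elim by (intro sampling)
      show ?case
        using elim(1) S.prob_coupon_time_bounds(1)[of "m n" "trials y n"] unfolding collected_prob_def by linarith
    qed
  next
    fix c assume c: "limit_cdf y < c"
    have "((\<lambda>z. limit_cdf y + (1 - limit_cdf z)) \<longlongrightarrow> limit_cdf y + (1 - 1)) at_top"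
      by (intro tendsto_intros limit_cdf_at_top)
    then have "eventually (\<lambda>z. limit_cdf y + (1 - limit_cdf z) < c) at_top"
      using c by (intro order_tendstoD(2)) auto
    then obtain z where z: "limit_cdf y + (1 - limit_cdf z) < c"
      by (auto simp: eventually_at_top_linorder)
    have "(\<lambda>n. collected_prob n (trials y n) + (1 - collected_prob n (trials z n))) \<longlonglongrightarrow> limit_cdf y + (1 - limit_cdf z)"
      by (intro tendsto_intros collected_prob_tendsto)
    from order_tendstoD(2)[OF this z] eventually_ge_at_top[of 1]
    show "eventually (\<lambda>n. ?T n < c) sequentially"
    proof eventually_elim
      case (elim n)
      interpret S: coupon_sampling "M n" n "X n" using elim by (intro sampling)
      show ?case
        using elim(1) S.prob_coupon_time_bounds(2)[of "m n" "trials y n" "trials z n"] unfolding collected_prob_def by linarith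
    qed
  qed
  moreover have "eventually (\<lambda>n. lam y n > 0) sequentially"
    using lam_at_top[of y] by (simp add: filterlim_at_top_dense)
  then have "eventually (\<lambda>n. ?T n = measure (M n) {\<omega> \<in> space (M n). real (coupon_time (m n) n (X n) \<omega>) \<le> real n * lam y n}) sequentially"
  proof eventually_elim
    case (elim n)
    then have "k \<le> trials y n \<longleftrightarrow> real k \<le> real n * lam y n" for k
      by (simp add: trials_def le_nat_iff le_floor_iff)
    then show ?case by simp
  qed
  ultimately show ?thesis by (rule Lim_transform_eventually)
qed

end

text \<open>On the half-line from \<beta> the function \<open>a - \<beta> * ln a\<close> increases
  strictly, since its derivative is \<open>1 - \<beta> / a\<close>. It starts one below the required
  value and tends to infinity, so the intermediate value theorem applies.\<close>

lemma alpha_ex1: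
  fixes \<beta> :: real
  assumes "\<beta> > 0"
  shows "\<exists>!a. a \<in> {\<beta><..} \<and> a - \<beta> * ln a = \<beta> - \<beta> * ln \<beta> + 1"
proof -
  let ?g = "\<lambda>a. a - \<beta> * ln a"
  have mono: "?g x < ?g y" if "\<beta> \<le> x" "x < y" for x y
  proof (rule DERIV_pos_imp_increasing_open[OF that(2)])
    fix z assume "x < z" "z < y"
    then show "\<exists>d. DERIV ?g z :> d \<and> d > 0"
      using that assms by (intro exI[of _ "1 - \<beta> / z"]) (auto intro!: derivative_eq_intros)
  qed (use that assms in \<open>auto intro!: continuous_intros\<close>)
  have "filterlim ?g at_top at_top" using assms by real_asymp
  then have "eventually (\<lambda>a. \<beta> - \<beta> * ln \<beta> + 1 \<le> ?g a \<and> \<beta> \<le> a) at_top"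
    by (intro eventually_conj eventually_ge_at_top) (simp add: filterlim_at_top)
  then obtain c where c: "\<beta> - \<beta> * ln \<beta> + 1 \<le> ?g c" "\<beta> \<le> c"
    by (auto simp: eventually_at_top_linorder)
  have "\<exists>a\<ge>\<beta>. a \<le> c \<and> ?g a = \<beta> - \<beta> * ln \<beta> + 1"
    using c assms by (intro IVT') (auto intro!: continuous_intros)
  then obtain a where a: "\<beta> \<le> a" "?g a = \<beta> - \<beta> * ln \<beta> + 1" by blast
  then have "a \<noteq> \<beta>" by auto
  with a have "a \<in> {\<beta><..}" by simp
  show ?thesis
  proof (rule ex1I[of _ a])
    fix x assume x: "x \<in> {\<beta><..} \<and> ?g x = \<beta> - \<beta> * ln \<beta> + 1"
    then show "x = a" using mono[of x a] mono[of a x] a by (cases x a rule: linorder_cases) auto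
  qed (use a \<open>a \<in> {\<beta><..}\<close> in auto)
qed

section \<open>Translation to the two normalized variables and the Gumbel law\<close>

theorem theorem6:
  fixes \<beta> \<alpha> C :: real and m :: "nat \<Rightarrow> nat" and b :: "nat \<Rightarrow> real"
    and M :: "nat \<Rightarrow> 'a measure" and X :: "nat \<Rightarrow> nat \<Rightarrow> 'a \<Rightarrow> nat"
  assumes "\<beta> > 0"
    and "\<And>n. n \<ge> 1 \<Longrightarrow> m n \<ge> 1"
    and "\<And>n. n \<ge> 2 \<Longrightarrow> real (m n) = \<beta> * ln (real n) + b n * ln (real n)"
    and "b \<in> o(\<lambda>n. 1 / sqrt (ln (real n)))"
    and "\<And>n. n \<ge> 1 \<Longrightarrow> coupon_sampling (M n) n (X n)"
    and "\<alpha> = (THE a. a \<in> {\<beta><..} \<and> a - \<beta> * ln a = \<beta> - \<beta> * ln \<beta> + 1)"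
    and "C = 1 / 2 * ln (2 * pi * (\<alpha> - \<beta>)\<^sup>2 / \<beta>)"
  shows "(\<exists>!a. a \<in> {\<beta><..} \<and> a - \<beta> * ln a = \<beta> - \<beta> * ln \<beta> + 1) \<and>
    (\<forall>y::real.
      (\<lambda>n. measure (M n) {\<omega> \<in> space (M n).
          (real (coupon_time (m n) n (X n) \<omega>)
             - \<alpha> * real n * ln (real n)
             - \<alpha> * (\<alpha> - \<beta> - 1) / (\<beta> * (\<alpha> - \<beta>)) * b n * real n * ln (real n)
             + \<alpha> / (2 * (\<alpha> - \<beta>)) * real n * ln (ln (real n)))
          / (\<alpha> / (\<alpha> - \<beta>) * real n) \<le> y})
      \<longlonglongrightarrow> exp (- (1 / sqrt (2 * pi) * (sqrt \<beta> / (\<alpha> - \<beta>)) * exp (- y)))) \<and>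
    weak_conv_m
      (\<lambda>n. distr (M n) borel (\<lambda>\<omega>.
          (\<alpha> - \<beta>) / \<alpha> * real (m n)
             * (real (coupon_time (m n) n (X n) \<omega>) / (real n * real (m n)) - \<alpha> / \<beta>)
          + b n / \<beta> * ln (real n) + ln (ln (real n)) / 2 + C))
      standard_gumbel"
proof -
  have ex1: "\<exists>!a. a \<in> {\<beta><..} \<and> a - \<beta> * ln a = \<beta> - \<beta> * ln \<beta> + 1"
    using assms(1) by (rule alpha_ex1)
  have \<alpha>: "\<beta> < \<alpha>" "\<alpha> - \<beta> * ln \<alpha> = \<beta> - \<beta> * ln \<beta> + 1"
    using theI'[OF ex1] unfolding assms(6)[symmetric] by auto
  interpret coupon_regime \<alpha> \<beta> m b M X
    by (rule coupon_regime.intro) (fact assms \<alpha>)+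
  define d where "d = \<alpha> - \<beta>"
  have d: "d > 0" and \<alpha>0: "\<alpha> > 0" using \<alpha>(1) assms(1) by (simp_all add: d_def)
  define Z where "Z = (\<lambda>n \<omega>. (real (coupon_time (m n) n (X n) \<omega>)
             - \<alpha> * real n * ln (real n)
             - \<alpha> * (\<alpha> - \<beta> - 1) / (\<beta> * (\<alpha> - \<beta>)) * b n * real n * ln (real n)
             + \<alpha> / (2 * (\<alpha> - \<beta>)) * real n * ln (ln (real n)))
          / (\<alpha> / (\<alpha> - \<beta>) * real n))"
  define W where "W = (\<lambda>n \<omega>. (\<alpha> - \<beta>) / \<alpha> * real (m n)
             * (real (coupon_time (m n) n (X n) \<omega>) / (real n * real (m n)) - \<alpha> / \<beta>)
          + b n / \<beta> * ln (real n) + ln (ln (real n)) / 2 + C)"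
  have Z_le: "Z n \<omega> \<le> y \<longleftrightarrow> real (coupon_time (m n) n (X n) \<omega>) \<le> real n * lam y n" if "n \<ge> 1" for n \<omega> y
  proof -
    have "Z n \<omega> \<le> y \<longleftrightarrow> real (coupon_time (m n) n (X n) \<omega>)
             - \<alpha> * real n * ln (real n)
             - \<alpha> * (\<alpha> - \<beta> - 1) / (\<beta> * (\<alpha> - \<beta>)) * b n * real n * ln (real n)
             + \<alpha> / (2 * (\<alpha> - \<beta>)) * real n * ln (ln (real n)) \<le> y * (\<alpha> / (\<alpha> - \<beta>) * real n)"
      unfolding Z_def using that d \<alpha>0 by (intro pos_divide_le_eq) (simp add: d_def)
    also have "\<dots> \<longleftrightarrow> real (coupon_time (m n) n (X n) \<omega>) \<le> real n * lam y n"
    proof -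
      have "T - p * N * l - k * B * N * l + q * N * z \<le> y * (r * N) \<longleftrightarrow> T \<le> N * (p * l + k * B * l - q * z + r * y)"
        for T p N l k B q z r :: real
        by (simp add: algebra_simps)
      then show ?thesis unfolding lam_def .
    qed
    finally show ?thesis .
  qed
  have Z_lim: "(\<lambda>n. measure (M n) {\<omega> \<in> space (M n). Z n \<omega> \<le> y}) \<longlonglongrightarrow> limit_cdf y" for y
    using coupon_time_tendsto
    by (rule Lim_transform_eventually) (use Z_le in \<open>auto intro!: eventually_sequentiallyI[of 1]\<close>)
  \<comment> \<open>Substituting \<open>m n = (\<beta> + b n) * ln n\<close> changes the centring by
    \<open>- (\<alpha> - \<beta>) * b n * ln n / \<beta>\<close>. With the explicit term in
    \<open>b n\<close> this yields the factor \<open>\<alpha> - \<beta> - 1\<close>, so the two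
    normalizations differ by the constant \<open>C\<close> alone.\<close>
  have W_eq: "W n \<omega> = Z n \<omega> + C" if "n \<ge> 2" for n \<omega>
  proof -
    define T where "T = real (coupon_time (m n) n (X n) \<omega>)"
    define l where "l = ln (real n)"
    define l2 where "l2 = ln l"
    have n: "real n > 0" and mn: "real (m n) > 0" using that assms(2)[of n] by auto
    have time: "(\<alpha> - \<beta>) / \<alpha> * real (m n) * (T / (real n * real (m n)) - \<alpha> / \<beta>)
       = d * T / (\<alpha> * real n) - d * real (m n) / \<beta>"
      using n mn \<alpha>0 assms(1) unfolding d_def[symmetric] by (simp add: field_simps)
    have shift: "d * real (m n) / \<beta> = d * l + d * (b n * l) / \<beta>"
      using assms(3)[OF that] assms(1) by (simp add: l_def field_simps)
    have "W n \<omega> = d * T / (\<alpha> * real n) - d * l - (d - 1) * (b n * l) / \<beta> + l2 / 2 + C"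
      unfolding W_def T_def[symmetric] l_def[symmetric] l2_def[symmetric] time shift
      by (simp add: left_diff_distrib diff_divide_distrib)
    moreover have "Z n \<omega> = d * T / (\<alpha> * real n) - d * l - (d - 1) * (b n * l) / \<beta> + l2 / 2"
      unfolding Z_def T_def[symmetric] l_def[symmetric] l2_def[symmetric] d_def[symmetric]
      using d \<alpha>0 n assms(1) by (simp add: field_simps)
    ultimately show ?thesis by simp
  qed
  \<comment> \<open>\<open>exp C\<close> is the reciprocal of the constant in
    \<open>limit_cdf\<close>, so the shift by \<open>C\<close> produces the standard Gumbel
    distribution.\<close>
  have limit_cdf_gumbel: "limit_cdf (y - C) = exp (- exp (- y))" for y
  proof -
    have "exp C = sqrt (2 * pi * d\<^sup>2 / \<beta>)"
      using d assms(1) unfolding assms(7) d_def[symmetric] by (simp add: ln_sqrt[symmetric])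
    also have "\<dots> = sqrt (2 * pi) * d / sqrt \<beta>"
      using d by (simp add: real_sqrt_mult real_sqrt_divide)
    finally have "sqrt \<beta> / (sqrt (2 * pi) * d) * exp C = 1"
      using d assms(1) by simp
    moreover have "exp (- (y - C)) = exp C * exp (- y)"
      by (simp flip: exp_add)
    ultimately show ?thesis
      unfolding limit_cdf_def d_def[symmetric] by (metis mult.assoc mult_1)
  qed
  have "weak_conv_m (\<lambda>n. distr (M n) borel (W n)) standard_gumbel"
    unfolding weak_conv_m_def weak_conv_def cdf_standard_gumbel
  proof (intro allI impI)
    fix y :: real
    have "(\<lambda>n. measure (M n) {\<omega> \<in> space (M n). Z n \<omega> \<le> y - C}) \<longlonglongrightarrow> exp (- exp (- y))"
      using Z_lim[of "y - C"] by (simp only: limit_cdf_gumbel)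
    then show "(\<lambda>n. cdf (distr (M n) borel (W n)) y) \<longlonglongrightarrow> exp (- exp (- y))"
    proof (rule Lim_transform_eventually, intro eventually_sequentiallyI[of 2])
      fix n :: nat assume n: "2 \<le> n"
      interpret S: coupon_sampling "M n" n "X n" using n by (intro sampling) simp
      have [measurable]: "W n \<in> borel_measurable (M n)"
        unfolding W_def by measurable
      have "cdf (distr (M n) borel (W n)) y = measure (M n) {\<omega> \<in> space (M n). W n \<omega> \<le> y}"
        unfolding cdf_def by (subst measure_distr) (auto intro!: arg_cong[where f = "measure (M n)"])
      also have "\<dots> = measure (M n) {\<omega> \<in> space (M n). Z n \<omega> \<le> y - C}"
        using W_eq[OF n] by (simp add: algebra_simps)
      finally show "measure (M n) {\<omega> \<in> space (M n). Z n \<omega> \<le> y - C} = cdf (distr (M n) borel (W n)) y" ..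
    qed
  qed
  moreover have "limit_cdf y = exp (- (1 / sqrt (2 * pi) * (sqrt \<beta> / (\<alpha> - \<beta>)) * exp (- y)))" for y
    by (simp add: limit_cdf_def)
  ultimately show ?thesis
    using ex1 Z_lim unfolding Z_def W_def by auto
qed

end
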